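(* Let $\phi$ be the Frobenius metric of the unitary group $U(2)$. The isometries of $(U(2), \phi)$ are precisely the following maps: $$X \mapsto AXB, \qquad X \mapsto AX^*B, \qquad X \mapsto \frac{AXB}{\det(X)}, \qquad X \mapsto \det(X)\,AX^*B,$$ with $A, B \in U(2)$.
   Context: $A^* = \overline{A}^T$ is the conjugate transpose. The Frobenius metric $\phi$ of $U(n)$ is the bi-invariant Riemannian metric obtained by restricting to $U(n)$ the flat metric $\phi(A,B) = \mathrm{Re}(\mathrm{tr}(AB^* ))$ of $M_n(\mathbb{C})$; explicitly, $\phi_A(X,Y) = -\mathrm{tr}(A^*XA^*Y)$ for every $A \in U(n)$ and $X, Y \in T_A(U(n))$. An isometry is a diffeomorphism of the group onto itself preserving the metric. *)

theory Defs
  imports "HOL-Analysis.Analysis"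
begin

section \<open>Smooth maps between subsets of Euclidean spaces\<close>

text \<open>\<open>Ck_on k f U\<close> is meant for open \<open>U\<close>. It asks for continuity of all iterated directional
  derivatives up to order \<open>k\<close>; over a finite-dimensional domain this is the usual \<open>C\<^sup>k\<close>.\<close>

primrec Ck_on :: "nat \<Rightarrow> ('a::euclidean_space \<Rightarrow> 'b::real_normed_vector) \<Rightarrow> 'a set \<Rightarrow> bool" where
  "Ck_on 0 f U \<longleftrightarrow> continuous_on U f"
| "Ck_on (Suc k) f U \<longleftrightarrow>
     (\<forall>x\<in>U. f differentiable (at x)) \<and>
     (\<forall>v. Ck_on k (\<lambda>x. frechet_derivative f (at x) v) U)"

text \<open>For an embedded submanifold \<open>S\<close>, being locally the restriction of a \<open>C\<^sup>\<infinity>\<close> map of the ambient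
  space is the same as being smooth in charts.\<close>

definition smooth_map_on :: "'a::euclidean_space set \<Rightarrow> ('a \<Rightarrow> 'b::real_normed_vector) \<Rightarrow> bool" where
  "smooth_map_on S f \<longleftrightarrow>
     (\<forall>x\<in>S. \<exists>U g. open U \<and> x \<in> U \<and> (\<forall>k. Ck_on k g U) \<and> (\<forall>y\<in>U \<inter> S. f y = g y))"

definition diffeomorphism_on :: "'a::euclidean_space set \<Rightarrow> ('a \<Rightarrow> 'a) \<Rightarrow> bool" where
  "diffeomorphism_on S f \<longleftrightarrow>
     bij_betw f S S \<and> smooth_map_on S f \<and> smooth_map_on S (inv_into S f)"

section \<open>Tangent spaces and Riemannian isometries\<close>

definition tangent_space :: "'a::euclidean_space set \<Rightarrow> 'a \<Rightarrow> 'a set" where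
  "tangent_space S p =
     {v. \<exists>\<epsilon>>0. \<exists>\<gamma>::real \<Rightarrow> 'a. \<gamma> ` {-\<epsilon><..<\<epsilon>} \<subseteq> S \<and> (\<forall>k. Ck_on k \<gamma> {-\<epsilon><..<\<epsilon>}) \<and>
         \<gamma> 0 = p \<and> (\<gamma> has_vector_derivative v) (at 0)}"

text \<open>A derivative of \<open>f\<close> at \<open>p\<close> within \<open>S\<close> is in general not unique as a linear map of the ambient
  space, but it is on \<open>tangent_space S p\<close>, where it is the differential of \<open>f\<close>:\<close>

lemma frechet_derivative_within_tangent:
  fixes f :: "'a::euclidean_space \<Rightarrow> 'b::real_normed_vector"
  assumes f: "f differentiable (at p within S)"
    and \<gamma>: "\<epsilon> > 0" "\<gamma> ` {-\<epsilon><..<\<epsilon>} \<subseteq> S" "\<gamma> 0 = p" "(\<gamma> has_vector_derivative v) (at (0::real))"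
  shows "((f \<circ> \<gamma>) has_vector_derivative frechet_derivative f (at p within S) v) (at 0)"
proof -
  have D: "(f has_derivative frechet_derivative f (at p within S)) (at p within S)"
    using f frechet_derivative_works by blast
  then have "(f has_derivative frechet_derivative f (at p within S))
               (at (\<gamma> 0) within \<gamma> ` {-\<epsilon><..<\<epsilon>})"
    using \<gamma> has_derivative_subset by metis
  moreover have "(\<gamma> has_vector_derivative v) (at 0 within {-\<epsilon><..<\<epsilon>})"
    using \<gamma>(4) has_vector_derivative_at_within by blast
  ultimately have
    "((f \<circ> \<gamma>) has_vector_derivative frechet_derivative f (at p within S) v)
       (at 0 within {-\<epsilon><..<\<epsilon>})"
    using vector_diff_chain_within vector_derivative_diff_chain_within by blast
  then show ?thesis
    using \<gamma>(1) by (simp add: at_within_open[of 0 "{-\<epsilon><..<\<epsilon>}"])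
qed

text \<open>A metric \<open>g\<close> takes the base point and two tangent vectors at it.\<close>

definition riemannian_isometry ::
  "'a::euclidean_space set \<Rightarrow> ('a \<Rightarrow> 'a \<Rightarrow> 'a \<Rightarrow> real) \<Rightarrow> ('a \<Rightarrow> 'a) \<Rightarrow> bool" where
  "riemannian_isometry S g f \<longleftrightarrow>
     diffeomorphism_on S f \<and>
     (\<forall>p\<in>S. \<forall>v\<in>tangent_space S p. \<forall>w\<in>tangent_space S p.
        g (f p) (frechet_derivative f (at p within S) v) (frechet_derivative f (at p within S) w)
          = g p v w)"

section \<open>The unitary group and its Frobenius metric\<close>

definition conj_transpose :: "complex ^ 'n ^ 'm \<Rightarrow> complex ^ 'm ^ 'n" ("_\<^sup>\<dagger>" [1000] 999) where
  "A\<^sup>\<dagger> = (\<chi> i j. cnj (A $ j $ i))"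

text \<open>\<open>*\<^sub>R\<close> on matrices only takes real scalars and \<open>*s\<close> acts on vectors.\<close>

definition cscale :: "complex \<Rightarrow> complex ^ 'n ^ 'm \<Rightarrow> complex ^ 'n ^ 'm" (infixr "*\<^sub>m" 75) where
  "c *\<^sub>m A = (\<chi> i j. c * A $ i $ j)"

definition unitary_group :: "(complex ^ 'n ^ 'n) set" where
  "unitary_group = {A. A ** A\<^sup>\<dagger> = mat 1 \<and> A\<^sup>\<dagger> ** A = mat 1}"

text \<open>The flat metric \<open>Re (tr (X Y\<^sup>*))\<close> of the matrix space; the base point plays no role.\<close>

definition frobenius_metric ::
  "complex ^ 'n ^ 'n \<Rightarrow> complex ^ 'n ^ 'n \<Rightarrow> complex ^ 'n ^ 'n \<Rightarrow> real" where
  "frobenius_metric A X Y = Re (trace (X ** Y\<^sup>\<dagger>))"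

end

theory Submission
  imports Defs
begin

text \<open>For commuting left- and right-invariant vector fields \<open>x Z\<close> and \<open>C x\<close> on \<open>U(n)\<close> the inner
  product \<open>\<langle>x Z, C x\<rangle>\<close> is constant along the flow of the first field and \<open>\<bar>x Z\<bar>\<close> is constant. An isometry
  \<open>f\<close> preserves both, so by the symmetry of second derivatives the acceleration of
  \<open>\<kappa>(t) = f (q exp(t Z))\<close> is normal to the group, i.e. \<open>\<kappa>\<^sup>* \<kappa>'\<close> is constant. Hence
  \<open>f (exp Z) = f(1) exp(L Z)\<close> with a linear isometry \<open>L\<close> of the skew-Hermitian matrices.
  On \<open>u(2) = \<real>i \<oplus> su(2)\<close>, \<open>L\<close> maps unit vectors of \<open>su(2)\<close>, whose one-parameter curves close up at
  time \<open>2\<pi>\<close>, to unit vectors with the same property, and this forces \<open>L\<close> to respect the splitting.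
  Thus \<open>L\<close> is \<open>\<plusminus>1\<close> on the centre and, up to conjugation by a unitary matrix, \<open>\<plusminus>1\<close> on \<open>su(2)\<close>; the four
  sign choices are the four families. Conversely \<open>det X X\<^sup>*\<close> is the adjugate of a unitary
  \<open>X \<in> U(2)\<close>, so every map in the list is the restriction of a linear isometry of the matrix space.\<close>

section \<open>Smooth maps\<close>

text \<open>On an open set the derivative at a point depends only on nearby values inside the set.
  The induction ranges over all pairs of functions because each step passes to their directional
  derivatives.\<close>

lemma Ck_on_cong:
  assumes "open U" "\<And>x. x \<in> U \<Longrightarrow> f x = g x"
  shows "Ck_on k f U \<longleftrightarrow> Ck_on k g U"
  using assms(2)
proof (induction k arbitrary: f g)
  case 0
  then show ?case by (simp cong: continuous_on_cong)
next
  case (Suc k)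
  have d: "f differentiable (at x) \<longleftrightarrow> g differentiable (at x)"
    and e: "frechet_derivative f (at x) = frechet_derivative g (at x)" if "x \<in> U" for x
  proof -
    have "(f has_derivative D) (at x) \<longleftrightarrow> (g has_derivative D) (at x)" for D
      using has_derivative_transform_within_open[OF _ assms(1) that] Suc.prems by metis
    then show "f differentiable (at x) \<longleftrightarrow> g differentiable (at x)"
      "frechet_derivative f (at x) = frechet_derivative g (at x)"
      by (auto simp: differentiable_def frechet_derivative_def)
  qed
  have "Ck_on k (\<lambda>x. frechet_derivative f (at x) v) U
      \<longleftrightarrow> Ck_on k (\<lambda>x. frechet_derivative g (at x) v) U" for v
    by (rule Suc.IH) (simp add: e)
  then show ?case using d by auto
qed

lemma Ck_on_const: "Ck_on k (\<lambda>x. c) U"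
  by (induction k arbitrary: c) (auto simp: frechet_derivative_const)

lemma Ck_on_bounded_linear:
  assumes "bounded_linear T"
  shows "Ck_on k T U"
proof (cases k)
  case 0
  then show ?thesis by (simp add: assms linear_continuous_on)
next
  case (Suc m)
  have "frechet_derivative T (at x) = T" for x
    using bounded_linear_imp_has_derivative[OF assms] frechet_derivative_at by metis
  then show ?thesis
    using Suc by (simp add: Ck_on_const bounded_linear_imp_differentiable assms)
qed

lemma Ck_on_bounded_linear_comp:
  assumes U: "open U" and T: "bounded_linear T" and f: "Ck_on k f U"
  shows "Ck_on k (\<lambda>x. T (f x)) U"
  using f
proof (induction k arbitrary: f)
  case 0
  then show ?case using bounded_linear.continuous_on[OF T] by simp
next
  case (Suc k)
  have D: "((\<lambda>x. T (f x)) has_derivative (\<lambda>v. T (frechet_derivative f (at x) v))) (at x)"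
    if "x \<in> U" for x
    by (rule bounded_linear.has_derivative[OF T])
      (use Suc.prems that in \<open>simp add: frechet_derivative_works\<close>)
  have "Ck_on k (\<lambda>x. frechet_derivative (\<lambda>x. T (f x)) (at x) v) U" for v
  proof -
    have "Ck_on k (\<lambda>x. T (frechet_derivative f (at x) v)) U"
      using Suc by auto
    moreover have "frechet_derivative (\<lambda>x. T (f x)) (at x) v = T (frechet_derivative f (at x) v)"
      if "x \<in> U" for x
      using D[OF that] frechet_derivative_at by metis
    ultimately show ?thesis
      by (subst Ck_on_cong[OF U]) auto
  qed
  then show ?case using D by (auto simp: differentiable_def)
qed

text \<open>Bootstrapping: the derivative of \<open>\<gamma>\<close> is \<open>T\<close> applied to
  \<open>\<gamma>\<close>, so each order of smoothness of \<open>\<gamma>\<close> yields the next.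
  This supplies the smoothness that \<open>tangent_space\<close> demands of its curves.\<close>

lemma Ck_on_linear_ode:
  fixes \<gamma> :: "real \<Rightarrow> 'b::real_normed_vector"
  assumes U: "open U" and T: "bounded_linear T"
    and \<gamma>: "\<And>t. t \<in> U \<Longrightarrow> (\<gamma> has_vector_derivative T (\<gamma> t)) (at t)"
  shows "Ck_on k \<gamma> U"
proof (induction k)
  case 0
  then show ?case
    using \<gamma> by (auto intro!: continuous_at_imp_continuous_on has_vector_derivative_continuous)
next
  case (Suc k)
  have "Ck_on k (\<lambda>t. frechet_derivative \<gamma> (at t) v) U" for v
  proof -
    have "bounded_linear (\<lambda>x. v *\<^sub>R T x)"
      using T bounded_linear_scaleR_right bounded_linear_compose by blast
    then have "Ck_on k (\<lambda>t. v *\<^sub>R T (\<gamma> t)) U"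
      using Ck_on_bounded_linear_comp[OF U _ Suc] by blast
    moreover have "frechet_derivative \<gamma> (at t) v = v *\<^sub>R T (\<gamma> t)" if "t \<in> U" for t
      using frechet_derivative_at[OF \<gamma>[OF that, unfolded has_vector_derivative_def]] by metis
    ultimately show ?thesis
      by (subst Ck_on_cong[OF U]) auto
  qed
  then show ?case
    using \<gamma> by (auto simp: differentiable_def has_vector_derivative_def)
qed

section \<open>Symmetry of second derivatives and differentiation along curves\<close>

lemma has_real_derivative_inner_line:
  fixes F :: "'a::real_normed_vector \<Rightarrow> 'b::real_inner"
  assumes "(F has_derivative F') (at (p + a *\<^sub>R z))"
  shows "((\<lambda>a. F (p + a *\<^sub>R z) \<bullet> w) has_real_derivative F' z \<bullet> w) (at a)"
proof -
  have "((\<lambda>a. p + a *\<^sub>R z) has_derivative (\<lambda>h. 0 + h *\<^sub>R z)) (at a)"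
    by (intro has_derivative_add has_derivative_const has_derivative_scaleR_left has_derivative_ident)
  then have "((\<lambda>a. F (p + a *\<^sub>R z)) has_derivative (\<lambda>h. F' (0 + h *\<^sub>R z))) (at a)"
    by (rule has_derivative_compose[where f = "\<lambda>a. p + a *\<^sub>R z" and g = F, OF _ assms])
  then have "((\<lambda>a. F (p + a *\<^sub>R z) \<bullet> w) has_derivative (\<lambda>h. F' (0 + h *\<^sub>R z) \<bullet> w)) (at a)"
    by (rule has_derivative_inner_left)
  moreover have "(\<lambda>h. F' (0 + h *\<^sub>R z) \<bullet> w) = (*) (F' z \<bullet> w)"
    by (simp add: fun_eq_iff linear_scale[OF has_derivative_linear[OF assms]])
  ultimately show ?thesis
    unfolding has_field_derivative_def by simp
qed

text \<open>Pairing with \<open>w\<close> gives real functions, for which the mean value theorem is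
  an equality. Applied first in direction \<open>u\<close> and then in direction \<open>v\<close>,
  it turns the second difference into the square of \<open>s\<close> times the mixed derivative at a
  nearby point, and continuity of that derivative gives the limit.\<close>

lemma second_difference_tendsto:
  fixes g :: "'a::euclidean_space \<Rightarrow> 'b::real_inner"
  assumes U: "open U" and g: "Ck_on (Suc (Suc 0)) g U" and q: "q \<in> U"
  shows "((\<lambda>s. ((g (q + s *\<^sub>R u + s *\<^sub>R v) - g (q + s *\<^sub>R u) - g (q + s *\<^sub>R v) + g q) \<bullet> w) / s\<^sup>2)
      \<longlongrightarrow> frechet_derivative (\<lambda>x. frechet_derivative g (at x) u) (at q) v \<bullet> w) (at_right 0)"
    (is "(?\<Delta> \<longlongrightarrow> ?D2 q \<bullet> w) _")
proof (rule tendstoI)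
  fix e :: real assume "e > 0"
  have D: "(g has_derivative frechet_derivative g (at x)) (at x)" if "x \<in> U" for x
    using g that by (simp add: frechet_derivative_works)
  have DD: "((\<lambda>x. frechet_derivative g (at x) u) has_derivative
      frechet_derivative (\<lambda>x. frechet_derivative g (at x) u) (at x)) (at x)" if "x \<in> U" for x
    using g that by (simp add: frechet_derivative_works)
  have "continuous_on U (\<lambda>x. ?D2 x \<bullet> w)"
    using g by (simp add: continuous_on_inner)
  then have "isCont (\<lambda>x. ?D2 x \<bullet> w) q"
    using U q continuous_on_eq_continuous_at by blast
  then obtain d1 where d1: "d1 > 0" "\<And>x. dist x q < d1 \<Longrightarrow> dist (?D2 x \<bullet> w) (?D2 q \<bullet> w) < e"
    using \<open>e > 0\<close> unfolding continuous_at_eps_delta by meson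
  obtain d2 where d2: "d2 > 0" "ball q d2 \<subseteq> U"
    using U q open_contains_ball by blast
  define d where "d = min d1 d2"
  \<comment> \<open>Steps of length below \<open>r\<close> in both directions keep the point within
    \<open>d\<close> of \<open>q\<close>; the summand 1 keeps the denominator positive when
    \<open>u\<close> and \<open>v\<close> are both zero.\<close>
  define r where "r = d / (norm u + norm v + 1)"
  have pos: "norm u + norm v + 1 > 0"
    by (meson add_nonneg_pos add_nonneg_nonneg norm_ge_zero zero_less_one)
  have "d > 0" using d1 d2 by (simp add: d_def)
  then have r: "r > 0" using pos by (simp add: r_def)
  have near: "dist (q + a *\<^sub>R u + b *\<^sub>R v) q < d"
    if "0 \<le> a" "a \<le> s" "0 \<le> b" "b \<le> s" "s < r" for a b s
  proof -
    have "norm (a *\<^sub>R u + b *\<^sub>R v) \<le> a * norm u + b * norm v"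
      using that norm_triangle_ineq[of "a *\<^sub>R u" "b *\<^sub>R v"] by simp
    also have "\<dots> \<le> s * norm u + s * norm v"
      using that by (intro add_mono mult_right_mono) auto
    also have "\<dots> \<le> s * (norm u + norm v + 1)"
      using that by (simp add: algebra_simps)
    also have "\<dots> < r * (norm u + norm v + 1)"
      using that pos by simp
    also have "\<dots> = d" using pos by (simp add: r_def)
    finally show ?thesis by (simp add: dist_norm)
  qed
  have inU: "q + a *\<^sub>R u + b *\<^sub>R v \<in> U"
    if "0 \<le> a" "a \<le> s" "0 \<le> b" "b \<le> s" "s < r" for a b s
    using near[OF that] d2(2) by (auto simp: d_def dist_commute subset_iff)
  have "dist (?\<Delta> s) (?D2 q \<bullet> w) < e" if s: "0 < s" "s < r" for s
  proof -
    let ?D = "\<lambda>x. frechet_derivative g (at x)"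
    \<comment> \<open>The second difference is the increment of \<open>?\<phi>\<close> from 0 to
      \<open>s\<close>: the difference in direction \<open>v\<close>, followed along
      \<open>u\<close>.\<close>
    let ?\<phi> = "\<lambda>a. g (q + s *\<^sub>R v + a *\<^sub>R u) \<bullet> w - g (q + a *\<^sub>R u) \<bullet> w"
    let ?\<phi>' = "\<lambda>a. ?D (q + s *\<^sub>R v + a *\<^sub>R u) u \<bullet> w - ?D (q + a *\<^sub>R u) u \<bullet> w"
    have "DERIV ?\<phi> a :> ?\<phi>' a" if "0 \<le> a" "a \<le> s" for a
    proof -
      have "q + s *\<^sub>R v + a *\<^sub>R u \<in> U" "q + a *\<^sub>R u \<in> U"
        using inU[of a s s] inU[of a s 0] that s by (simp_all add: add_ac)
      then show ?thesis
        using DERIV_diff[OF has_real_derivative_inner_line[of g _ "q + s *\<^sub>R v" a u w, OF D]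
            has_real_derivative_inner_line[of g _ q a u w, OF D]] by blast
    qed
    then obtain z where z: "0 < z" "z < s" "?\<phi> s - ?\<phi> 0 = (s - 0) * ?\<phi>' z"
      using MVT2[OF s(1), of ?\<phi> ?\<phi>'] by blast
    \<comment> \<open>The value \<open>?\<phi>' z\<close> is in turn the increment of
      \<open>?\<psi>\<close> from 0 to \<open>s\<close>, so a second mean value produces the mixed
      derivative.\<close>
    let ?\<psi> = "\<lambda>b. ?D (q + z *\<^sub>R u + b *\<^sub>R v) u \<bullet> w"
    let ?\<psi>' = "\<lambda>b. ?D2 (q + z *\<^sub>R u + b *\<^sub>R v) \<bullet> w"
    have "DERIV ?\<psi> b :> ?\<psi>' b" if "0 \<le> b" "b \<le> s" for b
    proof -
      have "q + z *\<^sub>R u + b *\<^sub>R v \<in> U"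
        using inU[of z s b] that z s by simp
      then show ?thesis
        using has_real_derivative_inner_line[of _ _ "q + z *\<^sub>R u" b v w, OF DD] by blast
    qed
    then obtain y where y: "0 < y" "y < s" "?\<psi> s - ?\<psi> 0 = (s - 0) * ?\<psi>' y"
      using MVT2[OF s(1), of ?\<psi> ?\<psi>'] by blast
    have "(g (q + s *\<^sub>R u + s *\<^sub>R v) - g (q + s *\<^sub>R u) - g (q + s *\<^sub>R v) + g q) \<bullet> w = ?\<phi> s - ?\<phi> 0"
      by (simp add: algebra_simps inner_diff_left inner_add_left)
    also have "\<dots> = s * (?\<psi> s - ?\<psi> 0)"
      using z(3) by (simp add: add_ac)
    also have "\<dots> = s\<^sup>2 * ?\<psi>' y"
      using y(3) by (simp add: power2_eq_square)
    finally have "?\<Delta> s = ?\<psi>' y" using s by simp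
    moreover have "dist (q + z *\<^sub>R u + y *\<^sub>R v) q < d1"
      using near[of z s y] z y s by (simp add: d_def)
    ultimately show ?thesis using d1(2) by simp
  qed
  then show "\<forall>\<^sub>F s in at_right 0. dist (?\<Delta> s) (?D2 q \<bullet> w) < e"
    unfolding eventually_at_right_field using r by blast
qed

text \<open>The second difference does not change when \<open>u\<close> and \<open>v\<close> are
  swapped, so its two limits coincide for every test vector \<open>w\<close>.\<close>

lemma second_derivative_symmetric:
  fixes g :: "'a::euclidean_space \<Rightarrow> 'b::real_inner"
  assumes "open U" "Ck_on (Suc (Suc 0)) g U" "q \<in> U"
  shows "frechet_derivative (\<lambda>x. frechet_derivative g (at x) u) (at q) v
       = frechet_derivative (\<lambda>x. frechet_derivative g (at x) v) (at q) u"
proof -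
  have "frechet_derivative (\<lambda>x. frechet_derivative g (at x) u) (at q) v \<bullet> w
      = frechet_derivative (\<lambda>x. frechet_derivative g (at x) v) (at q) u \<bullet> w" for w
  proof -
    have *: "g (q + s *\<^sub>R v + s *\<^sub>R u) - g (q + s *\<^sub>R v) - g (q + s *\<^sub>R u) + g q
        = g (q + s *\<^sub>R u + s *\<^sub>R v) - g (q + s *\<^sub>R u) - g (q + s *\<^sub>R v) + g q" for s
      by (simp add: algebra_simps)
    show ?thesis
      using second_difference_tendsto[OF assms, of v u w] second_difference_tendsto[OF assms, of u v w]
      unfolding * by (rule tendsto_unique[OF trivial_limit_at_right_real, rotated])
  qed
  then show ?thesis by (rule vector_eq_rdot[THEN iffD1, OF allI])
qed

text \<open>A product rule in which base point and direction both move. \<open>Ck_on\<close> only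
  controls derivatives in fixed directions, so the moving direction is expanded in the standard
  basis; the result is a finite sum of scalar functions times curves.\<close>

lemma has_vector_derivative_frechet_derivative_along:
  fixes g :: "'a::euclidean_space \<Rightarrow> 'b::real_normed_vector"
  assumes U: "open U" and g: "Ck_on (Suc (Suc 0)) g U" and xU: "x t \<in> U"
    and x: "(x has_vector_derivative x') (at t)" and v: "(v has_vector_derivative v') (at t)"
  shows "((\<lambda>t. frechet_derivative g (at (x t)) (v t)) has_vector_derivative
      frechet_derivative (\<lambda>y. frechet_derivative g (at y) (v t)) (at (x t)) x'
        + frechet_derivative g (at (x t)) v') (at t)"
proof -
  let ?D = "\<lambda>y. frechet_derivative g (at y)"
  let ?D2 = "\<lambda>b. frechet_derivative (\<lambda>y. ?D y b) (at (x t))"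
  have D: "linear (?D y)" if "y \<in> U" for y
    using g that linear_frechet_derivative by auto
  have expand: "?D y z = (\<Sum>b\<in>Basis. (z \<bullet> b) *\<^sub>R ?D y b)" if "y \<in> U" for y z
    using linear_sum[OF D[OF that], of "\<lambda>b. (z \<bullet> b) *\<^sub>R b" Basis]
    by (simp add: euclidean_representation linear_scale[OF D[OF that]])
  have DD: "((\<lambda>y. ?D y b) has_derivative ?D2 b) (at (x t))" for b
    using g xU by (simp add: frechet_derivative_works)
  have "((\<lambda>y. \<Sum>b\<in>Basis. (z \<bullet> b) *\<^sub>R ?D y b) has_derivative
      (\<lambda>u. \<Sum>b\<in>Basis. (z \<bullet> b) *\<^sub>R ?D2 b u)) (at (x t))" for z
    by (intro has_derivative_sum has_derivative_scaleR_right DD)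
  then have Dz: "((\<lambda>y. ?D y z) has_derivative (\<lambda>u. \<Sum>b\<in>Basis. (z \<bullet> b) *\<^sub>R ?D2 b u)) (at (x t))" for z
    by (rule has_derivative_transform_within_open[OF _ U xU]) (rule expand[symmetric])
  have D2: "?D2 z u = (\<Sum>b\<in>Basis. (z \<bullet> b) *\<^sub>R ?D2 b u)" for z u
    by (rule fun_cong[OF frechet_derivative_at[OF Dz], symmetric])
  have Db: "((\<lambda>t. ?D (x t) b) has_vector_derivative ?D2 b x') (at t)" for b
    by (rule vector_derivative_diff_chain_within[OF x has_derivative_at_withinI[OF DD], unfolded o_def])
  have vb: "((\<lambda>t. v t \<bullet> b) has_real_derivative v' \<bullet> b) (at t)" for b
    using bounded_linear.has_vector_derivative[OF bounded_linear_inner_left v]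
    by (simp add: has_real_derivative_iff_has_vector_derivative)
  have "((\<lambda>t. \<Sum>b\<in>Basis. (v t \<bullet> b) *\<^sub>R ?D (x t) b) has_vector_derivative
      (\<Sum>b\<in>Basis. (v t \<bullet> b) *\<^sub>R ?D2 b x' + (v' \<bullet> b) *\<^sub>R ?D (x t) b)) (at t)"
    by (intro has_vector_derivative_sum has_vector_derivative_scaleR vb Db)
  then have *: "((\<lambda>t. \<Sum>b\<in>Basis. (v t \<bullet> b) *\<^sub>R ?D (x t) b) has_vector_derivative
      (?D2 (v t) x' + ?D (x t) v')) (at t)"
    by (simp add: sum.distrib D2[of "v t"] expand[OF xU, of v'])
  have "isCont x t" using x has_vector_derivative_continuous by blast
  then obtain T where T: "open T" "t \<in> T" "\<And>s. s \<in> T \<Longrightarrow> x s \<in> U"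
    using continuous_at_open[of t x] U xU by metis
  show ?thesis
    by (rule has_vector_derivative_transform_within_open[OF * T(1,2)]) (rule expand[OF T(3), symmetric])
qed

section \<open>Matrices\<close>

lemma bilinear_matrix_mult:
  "bilinear ((**) :: complex ^ 'n ^ 'm \<Rightarrow> complex ^ 'p ^ 'n \<Rightarrow> complex ^ 'p ^ 'm)"
  unfolding bilinear_def
  by (auto intro!: linearI simp: matrix_matrix_mult_def vec_eq_iff sum.distrib algebra_simps
      scaleR_sum_right)

interpretation matmul: bounded_bilinear "(**) :: complex ^ 'n ^ 'm \<Rightarrow> complex ^ 'p ^ 'n \<Rightarrow> complex ^ 'p ^ 'm"
  using bilinear_matrix_mult bilinear_conv_bounded_bilinear by blast

lemma bilinear_cscale: "bilinear ((*\<^sub>m) :: complex \<Rightarrow> complex ^ 'n ^ 'm \<Rightarrow> complex ^ 'n ^ 'm)"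
  unfolding bilinear_def
  by (auto intro!: linearI simp: cscale_def vec_eq_iff algebra_simps)

interpretation cscale: bounded_bilinear "(*\<^sub>m) :: complex \<Rightarrow> complex ^ 'n ^ 'm \<Rightarrow> complex ^ 'n ^ 'm"
  using bilinear_cscale bilinear_conv_bounded_bilinear by blast

lemma cscale_cscale [simp]: "a *\<^sub>m b *\<^sub>m A = (a * b) *\<^sub>m A"
  by (simp add: cscale_def vec_eq_iff)

lemma one_cscale [simp]: "1 *\<^sub>m A = A"
  by (simp add: cscale_def vec_eq_iff)

lemma cscale_mult_left [simp]: "(c *\<^sub>m A) ** B = c *\<^sub>m (A ** B)"
  by (simp add: cscale_def matrix_matrix_mult_def vec_eq_iff sum_distrib_left mult_ac)

lemma cscale_mult_right [simp]: "A ** (c *\<^sub>m B) = c *\<^sub>m (A ** B)"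
  by (simp add: cscale_def matrix_matrix_mult_def vec_eq_iff sum_distrib_left mult_ac)

lemma trace_cscale [simp]: "trace (c *\<^sub>m A) = c * trace A"
  by (simp add: cscale_def trace_def sum_distrib_left)

lemma linear_conj_transpose: "linear (conj_transpose :: complex ^ 'n ^ 'm \<Rightarrow> complex ^ 'm ^ 'n)"
  by (rule linearI) (simp_all add: conj_transpose_def vec_eq_iff)

lemmas bounded_linear_conj_transpose = linear_conj_transpose[THEN linear_linear[THEN iffD2]]

lemmas conj_transpose_linear =
  linear_0[OF linear_conj_transpose] linear_add[OF linear_conj_transpose]
  linear_diff[OF linear_conj_transpose] linear_neg[OF linear_conj_transpose]
  linear_scale[OF linear_conj_transpose]

lemmas conj_transpose_has_vector_derivative =
  bounded_linear.has_vector_derivative[OF bounded_linear_conj_transpose]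

lemma conj_transpose_conj_transpose [simp]: "(A\<^sup>\<dagger>)\<^sup>\<dagger> = A"
  by (simp add: conj_transpose_def vec_eq_iff)

lemma conj_transpose_mult: "(A ** B)\<^sup>\<dagger> = B\<^sup>\<dagger> ** A\<^sup>\<dagger>"
  by (simp add: conj_transpose_def matrix_matrix_mult_def vec_eq_iff mult.commute)

lemma conj_transpose_mat_1 [simp]: "(mat 1)\<^sup>\<dagger> = mat 1"
  by (simp add: conj_transpose_def mat_def vec_eq_iff)

lemma conj_transpose_cscale [simp]: "(c *\<^sub>m A)\<^sup>\<dagger> = cnj c *\<^sub>m A\<^sup>\<dagger>"
  by (simp add: conj_transpose_def cscale_def vec_eq_iff)

text \<open>This identifies the metric with the Euclidean inner product that the matrix type already
  carries, so isometry becomes preservation of \<open>\<bullet>\<close>.\<close>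

lemma frobenius_metric_eq_inner: "frobenius_metric A X Y = X \<bullet> Y"
  by (simp add: frobenius_metric_def trace_def matrix_matrix_mult_def conj_transpose_def
      inner_vec_def inner_complex_def)

lemma inner_eq_trace: "X \<bullet> Y = Re (trace (X ** Y\<^sup>\<dagger>))" for X Y :: "complex ^ 'n ^ 'n"
  using frobenius_metric_eq_inner[of _ X Y] by (simp add: frobenius_metric_def)

lemma inner_mult_left: "(A ** X) \<bullet> Y = X \<bullet> (A\<^sup>\<dagger> ** Y)" for X Y :: "complex ^ 'n ^ 'n"
proof -
  have "trace (A ** (X ** Y\<^sup>\<dagger>)) = trace ((X ** Y\<^sup>\<dagger>) ** A)" by (rule trace_mul_sym)
  then show ?thesis by (simp add: inner_eq_trace conj_transpose_mult matrix_mul_assoc)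
qed

lemma inner_mult_right: "(X ** A) \<bullet> Y = X \<bullet> (Y ** A\<^sup>\<dagger>)" for X Y :: "complex ^ 'n ^ 'n"
  by (simp add: inner_eq_trace conj_transpose_mult matrix_mul_assoc)

lemma inner_conj_transpose: "X\<^sup>\<dagger> \<bullet> Y\<^sup>\<dagger> = X \<bullet> Y" for X Y :: "complex ^ 'n ^ 'n"
proof -
  have "X\<^sup>\<dagger> \<bullet> Y\<^sup>\<dagger> = (\<Sum>i\<in>UNIV. \<Sum>j\<in>UNIV. X $ j $ i \<bullet> Y $ j $ i)"
    by (simp add: inner_vec_def conj_transpose_def inner_complex_def)
  also have "\<dots> = X \<bullet> Y"
    by (subst sum.swap) (simp add: inner_vec_def)
  finally show ?thesis .
qed

lemma unitaryD:
  assumes "A \<in> unitary_group"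
  shows "A ** A\<^sup>\<dagger> = mat 1" "A\<^sup>\<dagger> ** A = mat 1" "X ** A ** A\<^sup>\<dagger> = X" "X ** A\<^sup>\<dagger> ** A = X"
    "A\<^sup>\<dagger> ** (A ** Y) = Y" "A ** (A\<^sup>\<dagger> ** Y) = Y"
  using assms by (auto simp: unitary_group_def matrix_mul_assoc[symmetric])
    (simp_all add: matrix_mul_assoc)

lemma mat_1_in_unitary_group [simp]: "mat 1 \<in> unitary_group"
  by (simp add: unitary_group_def)

lemma unitary_mult:
  assumes "A \<in> unitary_group" "B \<in> unitary_group"
  shows "A ** B \<in> unitary_group"
proof -
  have "A ** B ** (B\<^sup>\<dagger> ** A\<^sup>\<dagger>) = mat 1"
    by (simp only: matrix_mul_assoc unitaryD(3)[OF assms(2)] unitaryD(1)[OF assms(1)])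
  moreover have "B\<^sup>\<dagger> ** A\<^sup>\<dagger> ** (A ** B) = mat 1"
    by (simp only: matrix_mul_assoc unitaryD(4)[OF assms(1)] unitaryD(2)[OF assms(2)])
  ultimately show ?thesis
    by (simp add: unitary_group_def conj_transpose_mult)
qed

lemma unitary_conj_transpose: "A \<in> unitary_group \<Longrightarrow> A\<^sup>\<dagger> \<in> unitary_group"
  by (auto simp: unitary_group_def)

lemma inner_unitary_mult:
  assumes "A \<in> unitary_group"
  shows "(A ** X) \<bullet> (A ** Y) = X \<bullet> Y" "(X ** A) \<bullet> (Y ** A) = X \<bullet> Y"
  by (simp only: inner_mult_left unitaryD[OF assms]) (simp only: inner_mult_right unitaryD[OF assms])

section \<open>Skew-Hermitian matrices as the Lie algebra of the unitary group, and one-parameter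
  subgroups\<close>

definition skew :: "(complex ^ 'n ^ 'n) set" where
  "skew = {Z. Z\<^sup>\<dagger> = - Z}"

lemma subspace_skew: "subspace skew"
  by (auto simp: subspace_def skew_def conj_transpose_linear)

text \<open>Conjugate transposition preserves the inner product, fixes \<open>H\<close> and negates
  \<open>Z\<close>, so the product equals its own negative.\<close>

lemma hermitian_inner_skew:
  assumes "H\<^sup>\<dagger> = H" "Z \<in> skew"
  shows "H \<bullet> Z = 0"
  using inner_conj_transpose[of H Z] assms by (simp add: skew_def)

lemma skew_mult_conj:
  assumes "Z \<in> skew"
  shows "A ** Z ** A\<^sup>\<dagger> \<in> skew"
  using assms by (simp add: skew_def conj_transpose_mult matrix_mul_assoc matmul.minus_left matmul.minus_right)

text \<open>Obtained by differentiating the identity that \<open>\<kappa>\<close> times its adjoint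
  is 1. Membership at \<open>t\<close> itself is a separate hypothesis because the filter
  \<open>at t\<close> leaves that point out.\<close>

lemma unitary_curve_derivative:
  fixes \<kappa> :: "real \<Rightarrow> complex ^ 'n ^ 'n"
  assumes \<kappa>: "(\<kappa> has_vector_derivative v) (at t)"
    and U: "\<forall>\<^sub>F s in at t. \<kappa> s \<in> unitary_group" and Ut: "\<kappa> t \<in> unitary_group"
  shows "(\<kappa> t)\<^sup>\<dagger> ** v \<in> skew"
proof -
  have "((\<lambda>s. (\<kappa> s)\<^sup>\<dagger> ** \<kappa> s) has_vector_derivative (\<kappa> t)\<^sup>\<dagger> ** v + v\<^sup>\<dagger> ** \<kappa> t) (at t)"
    by (rule matmul.has_vector_derivative[OF conj_transpose_has_vector_derivative[OF \<kappa>] \<kappa>])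
  moreover have "((\<lambda>s. (\<kappa> s)\<^sup>\<dagger> ** \<kappa> s) has_vector_derivative 0) (at t)"
  proof -
    have "\<forall>\<^sub>F s in at t. mat 1 = (\<kappa> s)\<^sup>\<dagger> ** \<kappa> s"
      using U by eventually_elim (rule unitaryD(2)[symmetric])
    moreover have "mat 1 = (\<kappa> t)\<^sup>\<dagger> ** \<kappa> t"
      by (rule unitaryD(2)[OF Ut, symmetric])
    moreover have "((\<lambda>s. mat 1 :: complex ^ 'n ^ 'n) has_derivative (\<lambda>h. h *\<^sub>R 0)) (at t)"
      by simp
    ultimately show ?thesis
      unfolding has_vector_derivative_def
      using has_derivative_transform_eventually[of "\<lambda>s. mat 1" "\<lambda>h. h *\<^sub>R 0" t UNIV
          "\<lambda>s. (\<kappa> s)\<^sup>\<dagger> ** \<kappa> s"] by blast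
  qed
  ultimately have "(\<kappa> t)\<^sup>\<dagger> ** v + v\<^sup>\<dagger> ** \<kappa> t = 0"
    by (rule vector_derivative_unique_at)
  then show ?thesis
    by (simp add: skew_def conj_transpose_mult add_eq_0_iff)
qed

text \<open>This is the curve exp(t Z), described by its initial value and differential equation
  instead of a matrix exponential. Existence is carried as a hypothesis for general size and is
  settled for 2 by 2 matrices by an explicit formula.\<close>

definition one_param :: "complex ^ 'n ^ 'n \<Rightarrow> (real \<Rightarrow> complex ^ 'n ^ 'n) \<Rightarrow> bool" where
  "one_param Z e \<longleftrightarrow> e 0 = mat 1 \<and>
     (\<forall>t. e t \<in> unitary_group \<and> Z ** e t = e t ** Z \<and> (e has_vector_derivative e t ** Z) (at t))"

lemma one_paramD:
  assumes "one_param Z e"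
  shows "e 0 = mat 1" "e t \<in> unitary_group" "Z ** e t = e t ** Z"
    "(e has_vector_derivative e t ** Z) (at t)"
  using assms by (auto simp: one_param_def)

text \<open>Uniqueness for the linear equation: multiplying \<open>\<kappa> t\<close> by the inverse
  of \<open>e t\<close>, which is its adjoint, gives a curve whose derivative vanishes because
  \<open>\<omega>\<close> is skew-Hermitian.\<close>

lemma one_param_ode:
  fixes \<kappa> :: "real \<Rightarrow> complex ^ 'n ^ 'n"
  assumes e: "one_param \<omega> e" and \<omega>: "\<omega> \<in> skew"
    and \<kappa>: "\<And>t. (\<kappa> has_vector_derivative \<kappa> t ** \<omega>) (at t)"
  shows "\<kappa> t = \<kappa> 0 ** e t"
proof -
  have D: "((\<lambda>t. \<kappa> t ** (e t)\<^sup>\<dagger>) has_vector_derivative 0) (at t)" for t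
  proof -
    have "((\<lambda>t. \<kappa> t ** (e t)\<^sup>\<dagger>) has_vector_derivative
        \<kappa> t ** (e t ** \<omega>)\<^sup>\<dagger> + (\<kappa> t ** \<omega>) ** (e t)\<^sup>\<dagger>) (at t)"
      by (rule matmul.has_vector_derivative[OF \<kappa> conj_transpose_has_vector_derivative[OF one_paramD(4)[OF e]]])
    moreover have "\<kappa> t ** (e t ** \<omega>)\<^sup>\<dagger> + (\<kappa> t ** \<omega>) ** (e t)\<^sup>\<dagger> = 0"
      using \<omega> by (simp add: skew_def conj_transpose_mult matmul.minus_left matmul.minus_right matrix_mul_assoc)
    ultimately show ?thesis by simp
  qed
  obtain c where c: "\<And>t. t \<in> UNIV \<Longrightarrow> \<kappa> t ** (e t)\<^sup>\<dagger> = c"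
    by (rule has_vector_derivative_zero_constant[of UNIV "\<lambda>t. \<kappa> t ** (e t)\<^sup>\<dagger>"]) (auto intro: D)
  have "\<kappa> t = \<kappa> t ** (e t)\<^sup>\<dagger> ** e t"
    by (simp add: unitaryD(4)[OF one_paramD(2)[OF e]])
  also have "\<dots> = \<kappa> 0 ** (e 0)\<^sup>\<dagger> ** e t"
    by (simp only: c UNIV_I)
  finally show ?thesis
    by (simp add: one_paramD(1)[OF e])
qed

text \<open>The witnesses are the left and right translates of \<open>e\<close>. They solve linear
  differential equations, hence are smooth; being defined for all times, they can be cut down to the
  interval of radius 1.\<close>

lemma one_param_tangent:
  assumes e: "one_param Z e" and q: "q \<in> unitary_group"
  shows "q ** Z \<in> tangent_space unitary_group q" "Z ** q \<in> tangent_space unitary_group q"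
proof -
  have l: "((\<lambda>t. q ** e t) has_vector_derivative (q ** e t) ** Z) (at t)" for t
    using bounded_linear.has_vector_derivative[OF matmul.bounded_linear_right one_paramD(4)[OF e]]
    by (simp add: matrix_mul_assoc)
  have r: "((\<lambda>t. e t ** q) has_vector_derivative Z ** (e t ** q)) (at t)" for t
    using bounded_linear.has_vector_derivative[OF matmul.bounded_linear_left one_paramD(4)[OF e]]
    by (simp add: matrix_mul_assoc one_paramD(3)[OF e])
  have ln: "(\<lambda>t. q ** e t) ` {-1<..<1} \<subseteq> unitary_group" "(\<lambda>t. e t ** q) ` {-1<..<1} \<subseteq> unitary_group"
    using unitary_mult q one_paramD(2)[OF e] by auto
  have "Ck_on k (\<lambda>t. q ** e t) {-1<..<1}" for k
    by (rule Ck_on_linear_ode[OF _ matmul.bounded_linear_left l]) simp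
  then show "q ** Z \<in> tangent_space unitary_group q"
    unfolding tangent_space_def using l[of 0] ln one_paramD(1)[OF e]
    by (intro CollectI exI[of _ "1::real"] conjI exI[of _ "\<lambda>t. q ** e t"]) simp_all
  have "Ck_on k (\<lambda>t. e t ** q) {-1<..<1}" for k
    by (rule Ck_on_linear_ode[OF _ matmul.bounded_linear_right r]) simp
  then show "Z ** q \<in> tangent_space unitary_group q"
    unfolding tangent_space_def using r[of 0] ln one_paramD(1)[OF e]
    by (intro CollectI exI[of _ "1::real"] conjI exI[of _ "\<lambda>t. e t ** q"]) simp_all
qed

section \<open>Isometries map one-parameter curves to one-parameter curves\<close>

lemma right_curve:
  fixes p :: "complex ^ 'n ^ 'n"
  assumes "one_param Z e" "p \<in> unitary_group"
  shows "((\<lambda>s. e s ** p) has_vector_derivative Z ** (e s ** p)) (at s)" "e s ** p \<in> unitary_group"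
  using bounded_linear.has_vector_derivative[OF matmul.bounded_linear_left one_paramD(4)[OF assms(1)]]
  by (simp_all add: matrix_mul_assoc one_paramD(3)[OF assms(1)] unitary_mult one_paramD(2)[OF assms(1)] assms(2))

lemma left_curve:
  fixes p :: "complex ^ 'n ^ 'n"
  assumes "one_param Z e" "p \<in> unitary_group"
  shows "((\<lambda>s. p ** e s) has_vector_derivative (p ** e s) ** Z) (at s)" "p ** e s \<in> unitary_group"
  using bounded_linear.has_vector_derivative[OF matmul.bounded_linear_right one_paramD(4)[OF assms(1)]]
  by (simp_all add: matrix_mul_assoc unitary_mult one_paramD(2)[OF assms(1)] assms(2))

text \<open>Near each point an isometry is the restriction of a map \<open>g\<close> of the ambient
  matrix space. Working with \<open>g\<close> gives genuine derivatives of first and second order,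
  while unitarity and the metric condition are only known at points of the group.\<close>

locale unitary_local_isometry =
  fixes W :: "(complex ^ 'n ^ 'n) set" and g :: "complex ^ 'n ^ 'n \<Rightarrow> complex ^ 'n ^ 'n"
  assumes open_dom: "open W"
    and smooth: "Ck_on (Suc (Suc 0)) g W"
    and unitary: "p \<in> W \<Longrightarrow> p \<in> unitary_group \<Longrightarrow> g p \<in> unitary_group"
    and isometric: "p \<in> W \<Longrightarrow> p \<in> unitary_group
      \<Longrightarrow> v \<in> tangent_space unitary_group p \<Longrightarrow> w \<in> tangent_space unitary_group p
      \<Longrightarrow> frechet_derivative g (at p) v \<bullet> frechet_derivative g (at p) w = v \<bullet> w"
    and ex_one_param: "Z \<in> skew \<Longrightarrow> \<exists>e. one_param (Z :: complex ^ 'n ^ 'n) e"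
begin

abbreviation "D p \<equiv> frechet_derivative g (at p)"

lemma has_derivative_D: "p \<in> W \<Longrightarrow> (g has_derivative D p) (at p)"
  using smooth by (simp add: frechet_derivative_works)

lemma along:
  assumes "x t \<in> W" "(x has_vector_derivative x') (at t)"
  shows "((\<lambda>t. g (x t)) has_vector_derivative D (x t) x') (at t)"
  by (rule vector_derivative_diff_chain_within[OF assms(2)
        has_derivative_at_withinI[OF has_derivative_D[OF assms(1)]], unfolded o_def])

lemma eventually_in_dom:
  fixes x :: "real \<Rightarrow> complex ^ 'n ^ 'n"
  assumes "x t \<in> W" "(x has_vector_derivative x') (at t)"
  shows "\<exists>T. open T \<and> t \<in> T \<and> (\<forall>s\<in>T. x s \<in> W)"
  using has_vector_derivative_continuous[OF assms(2)] open_dom assms(1) continuous_at_open[of t x]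
  by metis

lemma tangent:
  fixes p :: "complex ^ 'n ^ 'n"
  assumes p: "p \<in> unitary_group" and Z: "Z \<in> skew"
  shows "Z ** p \<in> tangent_space unitary_group p" "p ** Z \<in> tangent_space unitary_group p"
  using one_param_tangent[OF _ p] ex_one_param[OF Z] by blast+

lemma D_tangent:
  assumes p: "p \<in> W" "p \<in> unitary_group" and Z: "Z \<in> skew"
  shows "(g p)\<^sup>\<dagger> ** D p (Z ** p) \<in> skew"
proof -
  obtain e where e: "one_param Z e" using ex_one_param[OF Z] by blast
  let ?y = "\<lambda>s. e s ** p"
  have y0: "?y 0 = p" by (simp add: one_paramD(1)[OF e])
  have y0': "(?y has_vector_derivative Z ** p) (at 0)"
    using right_curve(1)[OF e p(2), of 0] by (simp only: y0)
  obtain T where T: "open T" "0 \<in> T" "\<And>s. s \<in> T \<Longrightarrow> ?y s \<in> W"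
    using eventually_in_dom[of ?y 0, OF _ y0'] p(1) unfolding y0 by blast
  have "((\<lambda>s. g (?y s)) has_vector_derivative D (?y 0) (Z ** p)) (at 0)"
    by (rule along[OF _ y0']) (simp only: y0 p)
  moreover have "\<forall>\<^sub>F s in at 0. g (?y s) \<in> unitary_group"
    unfolding eventually_at_topological
    by (intro exI[of _ T] conjI T(1,2)) (use T(3) unitary right_curve(2)[OF e p(2)] in auto)
  moreover have "g (?y 0) \<in> unitary_group" using unitary[OF p] by (simp only: y0)
  ultimately have "(g (?y 0))\<^sup>\<dagger> ** D (?y 0) (Z ** p) \<in> skew"
    by (rule unitary_curve_derivative)
  then show ?thesis by (simp only: y0)
qed

text \<open>The differential preserves lengths on tangent vectors, hence is injective there, and it
  maps the tangent space at \<open>p\<close> into the one at \<open>g p\<close>. Both are translates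
  of \<open>skew\<close> and so have equal dimension. Thus every tangent vector at
  \<open>g p\<close> can be tested as an image under \<open>D p\<close>.\<close>

lemma D_tangent_surj:
  assumes p: "p \<in> W" "p \<in> unitary_group" and Z: "Z \<in> skew"
  shows "\<exists>C\<in>skew. g p ** Z = D p (C ** p)"
proof -
  let ?R = "\<lambda>C. C ** p" and ?L = "\<lambda>C. g p ** C"
  have lin: "linear ?R" "linear ?L"
    by (auto intro!: bounded_linear.linear matmul.bounded_linear_left matmul.bounded_linear_right)
  have linD: "linear (D p)" using has_derivative_linear[OF has_derivative_D[OF p(1)]] .
  have V: "subspace (?R ` skew)" "subspace (?L ` skew)"
    using subspace_skew lin by (auto intro: linear_subspace_image)
  have injR: "inj_on ?R A" for A
    by (rule inj_on_inverseI[of _ "\<lambda>X. X ** p\<^sup>\<dagger>"]) (rule unitaryD(3)[OF p(2)])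
  have injL: "inj_on ?L A" for A
    by (rule inj_on_inverseI[of _ "\<lambda>X. (g p)\<^sup>\<dagger> ** X"]) (rule unitaryD(5)[OF unitary[OF p]])
  have injD: "inj_on (D p) (?R ` skew)"
  proof (rule inj_onI)
    fix v w assume vw: "v \<in> ?R ` skew" "w \<in> ?R ` skew" and eq: "D p v = D p w"
    have "v - w \<in> ?R ` skew" by (rule subspace_diff[OF V(1) vw])
    then have "v - w \<in> tangent_space unitary_group p" using tangent(1)[OF p(2)] by auto
    then have "(v - w) \<bullet> (v - w) = D p (v - w) \<bullet> D p (v - w)"
      using isometric[OF p] by simp
    also have "D p (v - w) = 0" using eq linear_diff[OF linD] by simp
    finally show "v = w" by simp
  qed
  have "D p ` (?R ` skew) \<subseteq> ?L ` skew"
  proof clarify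
    fix C assume C: "C \<in> (skew :: (complex ^ 'n ^ 'n) set)"
    have "D p (C ** p) = g p ** ((g p)\<^sup>\<dagger> ** D p (C ** p))"
      by (rule unitaryD(6)[OF unitary[OF p], symmetric])
    then show "D p (C ** p) \<in> ?L ` skew" using D_tangent[OF p C] by (rule image_eqI)
  qed
  moreover have "dim (?L ` skew) \<le> dim (D p ` (?R ` skew))"
    by (simp add: dim_image_eq lin injR injL linD injD span_eq_iff[THEN iffD2, OF V(1)])
  ultimately have "D p ` (?R ` skew) = ?L ` skew"
    by (intro subspace_dim_equal linear_subspace_image[OF linD] V)
  then show ?thesis using Z by blast
qed

text \<open>The left-invariant field \<open>x \<mapsto> x Z\<close> and the right-invariant field \<open>x \<mapsto> C x\<close> commute, so with
  the symmetry of second derivatives the two constants \<open>\<langle>x Z, C x\<rangle>\<close> (along the first flow) and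
  \<open>\<langle>x Z, x Z\<rangle>\<close> (along the second) give the orthogonality.\<close>

lemma acceleration_normal:
  assumes p: "p \<in> W" "p \<in> unitary_group" and Z: "Z \<in> skew" and C: "C \<in> skew"
  shows "(frechet_derivative (\<lambda>y. D y (p ** Z)) (at p) (p ** Z) + D p (p ** Z ** Z)) \<bullet> D p (C ** p) = 0"
proof -
  let ?D2 = "\<lambda>v. frechet_derivative (\<lambda>y. D y v) (at p)"
  note ad = has_vector_derivative_frechet_derivative_along[OF open_dom smooth]
  note bil = bounded_bilinear.has_vector_derivative[OF bounded_bilinear_inner]
  obtain e where e: "one_param Z e" using ex_one_param[OF Z] by blast
  obtain c where c: "one_param C c" using ex_one_param[OF C] by blast
  \<comment> \<open>First constant: the product of the two fields is differentiated along the flow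
    of the left-invariant one.\<close>
  have 1: "D p (p ** Z) \<bullet> (?D2 (C ** p) (p ** Z) + D p (C ** p ** Z))
      + (?D2 (p ** Z) (p ** Z) + D p (p ** Z ** Z)) \<bullet> D p (C ** p) = 0"
  proof -
    let ?x = "\<lambda>s. p ** e s"
    have x0: "?x 0 = p" by (simp add: one_paramD(1)[OF e])
    have x0': "(?x has_vector_derivative p ** Z) (at 0)"
      using left_curve(1)[OF e p(2), of 0] by (simp only: x0)
    have xW: "?x 0 \<in> W" using p by (simp only: x0)
    have v: "((\<lambda>s. ?x s ** Z) has_vector_derivative p ** Z ** Z) (at 0)"
      by (rule bounded_linear.has_vector_derivative[OF matmul.bounded_linear_left x0'])
    have w: "((\<lambda>s. C ** ?x s) has_vector_derivative C ** (p ** Z)) (at 0)"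
      by (rule bounded_linear.has_vector_derivative[OF matmul.bounded_linear_right x0'])
    have "((\<lambda>s. D (?x s) (?x s ** Z) \<bullet> D (?x s) (C ** ?x s)) has_vector_derivative
        D (?x 0) (?x 0 ** Z) \<bullet> (frechet_derivative (\<lambda>y. D y (C ** ?x 0)) (at (?x 0)) (p ** Z)
            + D (?x 0) (C ** (p ** Z)))
        + (frechet_derivative (\<lambda>y. D y (?x 0 ** Z)) (at (?x 0)) (p ** Z)
            + D (?x 0) (p ** Z ** Z)) \<bullet> D (?x 0) (C ** ?x 0)) (at 0)"
      by (rule bil[OF ad[of ?x 0, OF xW x0' v] ad[of ?x 0, OF xW x0' w]])
    then have d: "((\<lambda>s. D (?x s) (?x s ** Z) \<bullet> D (?x s) (C ** ?x s)) has_vector_derivative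
        D p (p ** Z) \<bullet> (?D2 (C ** p) (p ** Z) + D p (C ** p ** Z))
      + (?D2 (p ** Z) (p ** Z) + D p (p ** Z ** Z)) \<bullet> D p (C ** p)) (at 0)"
      by (simp only: x0 matrix_mul_assoc)
    obtain T where T: "open T" "0 \<in> T" "\<And>s. s \<in> T \<Longrightarrow> ?x s \<in> W"
      using eventually_in_dom[of ?x 0, OF xW x0'] by blast
    have eq: "(p ** Z) \<bullet> (C ** p) = D (?x s) (?x s ** Z) \<bullet> D (?x s) (C ** ?x s)" if "s \<in> T" for s
    proof -
      have "D (?x s) (?x s ** Z) \<bullet> D (?x s) (C ** ?x s) = (?x s ** Z) \<bullet> (C ** ?x s)"
        using isometric[OF T(3)[OF that] left_curve(2)[OF e p(2)]]
          tangent[OF left_curve(2)[OF e p(2)]] Z C by blast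
      \<comment> \<open>Since \<open>e s\<close> commutes with \<open>Z\<close>, both vectors are
        right translates by \<open>e s\<close> of vectors at \<open>p\<close>, and right translation
        preserves the inner product.\<close>
      also have "\<dots> = (p ** Z ** e s) \<bullet> (C ** p ** e s)"
        by (simp only: matrix_mul_assoc[symmetric] one_paramD(3)[OF e])
      also have "\<dots> = (p ** Z) \<bullet> (C ** p)"
        by (rule inner_unitary_mult(2)[OF one_paramD(2)[OF e]])
      finally show ?thesis by simp
    qed
    have "((\<lambda>s. D (?x s) (?x s ** Z) \<bullet> D (?x s) (C ** ?x s)) has_vector_derivative 0) (at 0)"
      by (rule has_vector_derivative_transform_within_open[OF has_vector_derivative_const T(1,2) eq])
    then show ?thesis by (rule vector_derivative_unique_at[OF d])
  qed
  \<comment> \<open>Second constant: the squared length of the left-invariant field is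
    differentiated along the flow of the right-invariant one. The same vector
    \<open>C ** p ** Z\<close> appears as in the first computation, because the two fields
    commute.\<close>
  have 2: "D p (p ** Z) \<bullet> (?D2 (p ** Z) (C ** p) + D p (C ** p ** Z)) = 0"
  proof -
    let ?x = "\<lambda>s. c s ** p"
    have x0: "?x 0 = p" by (simp add: one_paramD(1)[OF c])
    have x0': "(?x has_vector_derivative C ** p) (at 0)"
      using right_curve(1)[OF c p(2), of 0] by (simp only: x0)
    have xW: "?x 0 \<in> W" using p by (simp only: x0)
    have v: "((\<lambda>s. ?x s ** Z) has_vector_derivative C ** p ** Z) (at 0)"
      by (rule bounded_linear.has_vector_derivative[OF matmul.bounded_linear_left x0'])
    have "((\<lambda>s. D (?x s) (?x s ** Z) \<bullet> D (?x s) (?x s ** Z)) has_vector_derivative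
        D (?x 0) (?x 0 ** Z) \<bullet> (frechet_derivative (\<lambda>y. D y (?x 0 ** Z)) (at (?x 0)) (C ** p)
            + D (?x 0) (C ** p ** Z))
        + (frechet_derivative (\<lambda>y. D y (?x 0 ** Z)) (at (?x 0)) (C ** p)
            + D (?x 0) (C ** p ** Z)) \<bullet> D (?x 0) (?x 0 ** Z)) (at 0)"
      by (rule bil[OF ad[of ?x 0, OF xW x0' v] ad[of ?x 0, OF xW x0' v]])
    then have d: "((\<lambda>s. D (?x s) (?x s ** Z) \<bullet> D (?x s) (?x s ** Z)) has_vector_derivative
        2 * (D p (p ** Z) \<bullet> (?D2 (p ** Z) (C ** p) + D p (C ** p ** Z)))) (at 0)"
      by (simp only: x0 inner_commute mult_2)
    obtain T where T: "open T" "0 \<in> T" "\<And>s. s \<in> T \<Longrightarrow> ?x s \<in> W"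
      using eventually_in_dom[of ?x 0, OF xW x0'] by blast
    have eq: "Z \<bullet> Z = D (?x s) (?x s ** Z) \<bullet> D (?x s) (?x s ** Z)" if "s \<in> T" for s
    proof -
      have "D (?x s) (?x s ** Z) \<bullet> D (?x s) (?x s ** Z) = (?x s ** Z) \<bullet> (?x s ** Z)"
        using isometric[OF T(3)[OF that] right_curve(2)[OF c p(2)]]
          tangent[OF right_curve(2)[OF c p(2)]] Z by blast
      also have "\<dots> = Z \<bullet> Z"
        by (rule inner_unitary_mult(1)[OF right_curve(2)[OF c p(2)]])
      finally show ?thesis by simp
    qed
    have "((\<lambda>s. D (?x s) (?x s ** Z) \<bullet> D (?x s) (?x s ** Z)) has_vector_derivative 0) (at 0)"
      by (rule has_vector_derivative_transform_within_open[OF has_vector_derivative_const T(1,2) eq])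
    then have "2 * (D p (p ** Z) \<bullet> (?D2 (p ** Z) (C ** p) + D p (C ** p ** Z))) = 0"
      by (rule vector_derivative_unique_at[OF d])
    then show ?thesis by simp
  qed
  \<comment> \<open>The symmetry makes the first summand of the first identity equal to the
    expression that vanishes by the second; what is left is the acceleration term.\<close>
  have "?D2 (C ** p) (p ** Z) = ?D2 (p ** Z) (C ** p)"
    by (rule second_derivative_symmetric[OF open_dom smooth p(1)])
  then show ?thesis using 1 2 by simp
qed

end

section \<open>From local extensions to the linear map on the Lie algebra\<close>

lemma isometry_extension:
  fixes f :: "complex ^ 'n ^ 'n \<Rightarrow> complex ^ 'n ^ 'n"
  assumes iso: "riemannian_isometry unitary_group frobenius_metric f"
    and ex: "\<And>Z :: complex ^ 'n ^ 'n. Z \<in> skew \<Longrightarrow> \<exists>e. one_param Z e"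
    and q: "q \<in> unitary_group"
  obtains W g where "unitary_local_isometry W g" "q \<in> W"
    "\<And>y. y \<in> W \<Longrightarrow> y \<in> unitary_group \<Longrightarrow> f y = g y"
proof -
  have bij: "bij_betw f unitary_group unitary_group"
    and sm: "smooth_map_on unitary_group f"
    using iso by (simp_all add: riemannian_isometry_def diffeomorphism_on_def)
  have met: "frechet_derivative f (at p within unitary_group) v
        \<bullet> frechet_derivative f (at p within unitary_group) w = v \<bullet> w"
      if "p \<in> unitary_group" "v \<in> tangent_space unitary_group p"
        "w \<in> tangent_space unitary_group p" for p v w
    using iso that by (simp add: riemannian_isometry_def frobenius_metric_eq_inner)
  have "\<exists>W g. open W \<and> q \<in> W \<and> (\<forall>k. Ck_on k g W) \<and> (\<forall>y\<in>W \<inter> unitary_group. f y = g y)"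
    using sm q unfolding smooth_map_on_def by (rule bspec)
  then obtain W g where W: "open W" "q \<in> W" and g: "\<And>k. Ck_on k g W"
    and fg: "\<And>y. y \<in> W \<Longrightarrow> y \<in> unitary_group \<Longrightarrow> f y = g y"
    by auto
  have D: "(g has_derivative frechet_derivative g (at p)) (at p)" if "p \<in> W" for p
    using g[of "Suc 0"] that by (simp add: frechet_derivative_works)
  \<comment> \<open>A derivative within the group is only determined on tangent vectors. There both
    sides are the velocity of \<open>f \<circ> \<gamma>\<close> at 0, since \<open>f\<close> and
    \<open>g\<close> agree on the group near \<open>p\<close>.\<close>
  have same: "frechet_derivative f (at p within unitary_group) v = frechet_derivative g (at p) v"
    if p: "p \<in> W" "p \<in> unitary_group" and v: "v \<in> tangent_space unitary_group p" for p v
  proof -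
    obtain \<epsilon> and \<gamma> :: "real \<Rightarrow> complex ^ 'n ^ 'n"
      where \<epsilon>: "\<epsilon> > 0" and \<gamma>: "\<gamma> ` {-\<epsilon><..<\<epsilon>} \<subseteq> unitary_group" "\<gamma> 0 = p"
        "(\<gamma> has_vector_derivative v) (at 0)"
      using v unfolding tangent_space_def by blast
    have "\<forall>\<^sub>F x in at p within unitary_group. g x = f x"
      unfolding eventually_at_topological
      by (intro exI[of _ W] conjI W(1) p(1)) (use fg in auto)
    then have "(f has_derivative frechet_derivative g (at p)) (at p within unitary_group)"
      by (rule has_derivative_transform_eventually[OF has_derivative_at_withinI[OF D[OF p(1)]]])
        (use fg p in auto)
    then have "f differentiable (at p within unitary_group)"
      by (rule differentiableI)
    then have 1: "((f \<circ> \<gamma>) has_vector_derivative frechet_derivative f (at p within unitary_group) v) (at 0)"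
      by (rule frechet_derivative_within_tangent[OF _ \<epsilon> \<gamma>])
    have 2: "((g \<circ> \<gamma>) has_vector_derivative frechet_derivative g (at p) v) (at 0)"
      by (rule vector_derivative_diff_chain_within[OF \<gamma>(3)])
        (simp add: \<gamma>(2) has_derivative_at_withinI D p)
    obtain T where T: "open T" "0 \<in> T" "\<And>s. s \<in> T \<Longrightarrow> \<gamma> s \<in> W"
      using has_vector_derivative_continuous[OF \<gamma>(3)] W(1) p(1) \<gamma>(2) continuous_at_open[of 0 \<gamma>]
      by metis
    have "((f \<circ> \<gamma>) has_vector_derivative frechet_derivative g (at p) v) (at 0)"
      by (rule has_vector_derivative_transform_within_open[OF 2, of "T \<inter> {-\<epsilon><..<\<epsilon>}"])
        (use T \<epsilon> \<gamma>(1) fg in \<open>auto simp: image_subset_iff\<close>)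
    then show ?thesis by (rule vector_derivative_unique_at[OF 1])
  qed
  have "unitary_local_isometry W g"
  proof
    show "open W" "Ck_on (Suc (Suc 0)) g W" by (fact W g)+
    show "g p \<in> unitary_group" if "p \<in> W" "p \<in> unitary_group" for p
      using bij_betw_apply[OF bij that(2)] by (simp only: fg[OF that])
    show "frechet_derivative g (at p) v \<bullet> frechet_derivative g (at p) w = v \<bullet> w"
      if "p \<in> W" "p \<in> unitary_group" "v \<in> tangent_space unitary_group p"
        "w \<in> tangent_space unitary_group p" for p v w
      using met[OF that(2-4)] by (simp only: same[OF that(1,2,3)] same[OF that(1,2,4)])
    show "\<exists>e. one_param Z e" if "Z \<in> skew" for Z :: "complex ^ 'n ^ 'n"
      by (rule ex[OF that])
  qed
  then show thesis using that W(2) fg by blast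
qed

lemma eq_0_if_orthogonal_skew:
  assumes "Z \<in> skew" "\<And>C. C \<in> skew \<Longrightarrow> Z \<bullet> C = 0"
  shows "Z = 0"
  using assms(2)[OF assms(1)] by simp

text \<open>For the image curve \<open>\<kappa>\<close>, the left-translated velocity
  \<open>\<omega>\<close> is skew-Hermitian, hence so is its derivative. That derivative is also
  orthogonal to \<open>skew\<close>: one summand comes from the normal acceleration and the other is
  Hermitian. So it is zero and \<open>\<omega>\<close> is constant.\<close>

lemma isometry_ode:
  fixes f :: "complex ^ 'n ^ 'n \<Rightarrow> complex ^ 'n ^ 'n"
  assumes iso: "riemannian_isometry unitary_group frobenius_metric f"
    and ex: "\<And>Z :: complex ^ 'n ^ 'n. Z \<in> skew \<Longrightarrow> \<exists>e. one_param Z e"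
    and q: "q \<in> unitary_group" and Z: "Z \<in> skew" and e: "one_param Z e"
  obtains \<omega> where "\<omega> \<in> skew"
    "\<And>t. ((\<lambda>t. f (q ** e t)) has_vector_derivative f (q ** e t) ** \<omega>) (at t)"
proof -
  let ?x = "\<lambda>t. q ** e t"
  define \<kappa> where "\<kappa> t = f (?x t)" for t
  \<comment> \<open>The local extension \<open>g\<close> changes with \<open>t\<close>, so the
    velocity needs a description that does not mention it.\<close>
  define \<kappa>' where "\<kappa>' t = vector_derivative \<kappa> (at t)" for t
  note x' = left_curve(1)[OF e q] and xU = left_curve(2)[OF e q]
  have \<kappa>U: "\<kappa> t \<in> unitary_group" for t
    using iso bij_betw_apply[of f unitary_group unitary_group, OF _ xU[of t]]
    by (simp add: \<kappa>_def riemannian_isometry_def diffeomorphism_on_def)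
  have key: "(\<kappa> has_vector_derivative \<kappa>' t) (at t) \<and>
      (\<exists>a. (\<kappa>' has_vector_derivative a) (at t) \<and> (\<forall>C\<in>skew. a \<bullet> (\<kappa> t ** C) = 0))" for t
  proof -
    obtain W g where ul: "unitary_local_isometry W g" and W: "?x t \<in> W"
      and fg: "\<And>y. y \<in> W \<Longrightarrow> y \<in> unitary_group \<Longrightarrow> f y = g y"
      using isometry_extension[OF iso ex xU] by blast
    interpret unitary_local_isometry W g by (rule ul)
    obtain T where T: "open T" "t \<in> T" "\<And>s. s \<in> T \<Longrightarrow> ?x s \<in> W"
      using eventually_in_dom[of ?x t, OF W x'] by blast
    have v: "((\<lambda>s. ?x s ** Z) has_vector_derivative ?x t ** Z ** Z) (at t)"
      by (rule bounded_linear.has_vector_derivative[OF matmul.bounded_linear_left x'])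
    have \<kappa>': "(\<kappa> has_vector_derivative D (?x s) (?x s ** Z)) (at s)" if "s \<in> T" for s
      by (rule has_vector_derivative_transform_within_open[OF along[of ?x s, OF T(3)[OF that] x'] T(1) that])
        (simp add: \<kappa>_def fg[OF T(3) xU])
    have eq: "D (?x s) (?x s ** Z) = \<kappa>' s" if "s \<in> T" for s
      unfolding \<kappa>'_def by (rule vector_derivative_at[OF \<kappa>'[OF that], symmetric])
    let ?a = "frechet_derivative (\<lambda>y. D y (?x t ** Z)) (at (?x t)) (?x t ** Z) + D (?x t) (?x t ** Z ** Z)"
    have "(\<kappa>' has_vector_derivative ?a) (at t)"
      by (rule has_vector_derivative_transform_within_open[OF
            has_vector_derivative_frechet_derivative_along[of _ _ ?x, OF open_dom smooth W x' v] T(1,2) eq])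
    moreover have "?a \<bullet> (\<kappa> t ** C) = 0" if C: "C \<in> skew" for C
    proof -
      obtain C' where C': "C' \<in> skew" "g (?x t) ** C = D (?x t) (C' ** ?x t)"
        using D_tangent_surj[OF W xU C] by blast
      have "\<kappa> t = g (?x t)" by (simp add: \<kappa>_def fg[OF W xU])
      then show ?thesis using acceleration_normal[OF W xU Z C'(1)] C'(2) by simp
    qed
    ultimately show ?thesis using \<kappa>'[OF T(2)] eq[OF T(2)] by auto
  qed
  define \<omega> where "\<omega> t = (\<kappa> t)\<^sup>\<dagger> ** \<kappa>' t" for t
  have skew: "\<omega> t \<in> skew" for t
    unfolding \<omega>_def
    by (rule unitary_curve_derivative[OF conjunct1[OF key] _ \<kappa>U]) (simp add: \<kappa>U)
  have "(\<omega> has_vector_derivative 0) (at t)" for t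
  proof -
    obtain a where a: "(\<kappa>' has_vector_derivative a) (at t)" "\<And>C. C \<in> skew \<Longrightarrow> a \<bullet> (\<kappa> t ** C) = 0"
      using key by blast
    let ?b = "(\<kappa> t)\<^sup>\<dagger> ** a + (\<kappa>' t)\<^sup>\<dagger> ** \<kappa>' t"
    have b: "(\<omega> has_vector_derivative ?b) (at t)"
      unfolding \<omega>_def
      by (rule matmul.has_vector_derivative[OF
            conj_transpose_has_vector_derivative[OF conjunct1[OF key]] a(1)])
    \<comment> \<open>Differentiating the skewness relation of \<open>\<omega>\<close>, which holds
      at all times, shows that \<open>?b\<close> is skew-Hermitian too.\<close>
    have "((\<lambda>t. (\<omega> t)\<^sup>\<dagger> + \<omega> t) has_vector_derivative ?b\<^sup>\<dagger> + ?b) (at t)"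
      by (rule has_vector_derivative_add[OF conj_transpose_has_vector_derivative[OF b] b])
    moreover have "(\<lambda>t. (\<omega> t)\<^sup>\<dagger> + \<omega> t) = (\<lambda>t. 0)"
      using skew by (simp add: skew_def)
    ultimately have "((\<lambda>t. 0) has_vector_derivative ?b\<^sup>\<dagger> + ?b) (at t)" by simp
    then have "?b\<^sup>\<dagger> + ?b = 0"
      by (rule vector_derivative_unique_at[OF _ has_vector_derivative_const])
    then have "?b \<in> skew"
      unfolding skew_def by (simp only: mem_Collect_eq eq_neg_iff_add_eq_0)
    moreover have "?b \<bullet> C = 0" if "C \<in> skew" for C
    proof -
      have "((\<kappa> t)\<^sup>\<dagger> ** a) \<bullet> C = 0"
        using a(2)[OF that] inner_mult_left[of "(\<kappa> t)\<^sup>\<dagger>" a C] by simp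
      moreover have "((\<kappa>' t)\<^sup>\<dagger> ** \<kappa>' t) \<bullet> C = 0"
        by (rule hermitian_inner_skew[OF _ that]) (simp add: conj_transpose_mult)
      ultimately show ?thesis by (simp add: inner_add_left)
    qed
    ultimately have "?b = 0" by (rule eq_0_if_orthogonal_skew)
    then show ?thesis using b by simp
  qed
  then obtain c where c: "\<And>t. t \<in> UNIV \<Longrightarrow> \<omega> t = c"
    using has_vector_derivative_zero_constant[of UNIV \<omega>] by auto
  have "\<kappa>' t = \<kappa> t ** c" for t
    unfolding c[OF UNIV_I, of t, symmetric] \<omega>_def by (rule unitaryD(6)[OF \<kappa>U, symmetric])
  then have "(\<kappa> has_vector_derivative \<kappa> t ** c) (at t)" for t
    using conjunct1[OF key, of t] by simp
  then show thesis
    using that[of c] skew[of 0] c[of 0] by (simp add: \<kappa>_def[abs_def])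
qed

text \<open>\<open>L\<close> is the differential at the identity, translated back by the inverse of
  \<open>f (mat 1)\<close>. Comparing velocities at time 0 shows that the constant from
  \<open>isometry_ode\<close> is \<open>L Z\<close>; uniqueness for the linear equation then gives
  the whole image curve.\<close>

lemma isometry_one_param:
  fixes f :: "complex ^ 'n ^ 'n \<Rightarrow> complex ^ 'n ^ 'n"
  assumes iso: "riemannian_isometry unitary_group frobenius_metric f"
    and ex: "\<And>Z :: complex ^ 'n ^ 'n. Z \<in> skew \<Longrightarrow> \<exists>e. one_param Z e"
  obtains L where "linear L" "\<And>Z. Z \<in> skew \<Longrightarrow> L Z \<in> skew"
    "\<And>Z Z'. Z \<in> skew \<Longrightarrow> Z' \<in> skew \<Longrightarrow> L Z \<bullet> L Z' = Z \<bullet> Z'"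
    "\<And>Z e e' t. Z \<in> skew \<Longrightarrow> one_param Z e \<Longrightarrow> one_param (L Z) e' \<Longrightarrow> f (e t) = f (mat 1) ** e' t"
proof -
  obtain W g where ul: "unitary_local_isometry W g" and W: "mat 1 \<in> W"
    and fg: "\<And>y. y \<in> W \<Longrightarrow> y \<in> unitary_group \<Longrightarrow> f y = g y"
    using isometry_extension[OF iso ex mat_1_in_unitary_group] by blast
  interpret unitary_local_isometry W g by (rule ul)
  let ?I = "mat 1 :: complex ^ 'n ^ 'n"
  note gU = unitary[OF W mat_1_in_unitary_group]
  define L where "L Z = (g ?I)\<^sup>\<dagger> ** D ?I Z" for Z
  have "linear L"
    unfolding L_def
    by (rule linear_compose[OF has_derivative_linear[OF has_derivative_D[OF W]]
          bounded_linear.linear[OF matmul.bounded_linear_right], unfolded o_def])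
  moreover have "L Z \<in> skew" if "Z \<in> skew" for Z
    using D_tangent[OF W mat_1_in_unitary_group that] by (simp add: L_def)
  moreover have "L Z \<bullet> L Z' = Z \<bullet> Z'" if Z: "Z \<in> skew" "Z' \<in> skew" for Z Z'
  proof -
    have "Z \<in> tangent_space unitary_group ?I" "Z' \<in> tangent_space unitary_group ?I"
      using tangent(1)[OF mat_1_in_unitary_group Z(1)] tangent(1)[OF mat_1_in_unitary_group Z(2)]
      by simp_all
    then show ?thesis
      unfolding L_def inner_unitary_mult(1)[OF unitary_conj_transpose[OF gU]]
      by (rule isometric[OF W mat_1_in_unitary_group])
  qed
  moreover have "f (e t) = f ?I ** e' t"
    if Z: "Z \<in> skew" and e: "one_param Z e" and e': "one_param (L Z) e'" for Z e e' t
  proof -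
    obtain \<omega> where \<omega>: "\<omega> \<in> skew"
      "\<And>t. ((\<lambda>t. f (?I ** e t)) has_vector_derivative f (?I ** e t) ** \<omega>) (at t)"
      using isometry_ode[OF iso ex mat_1_in_unitary_group Z e] by blast
    have \<omega>': "((\<lambda>t. f (e t)) has_vector_derivative f (e t) ** \<omega>) (at t)" for t
      using \<omega>(2)[of t] by simp
    have e0: "e 0 = ?I" by (rule one_paramD(1)[OF e])
    have e0': "(e has_vector_derivative Z) (at 0)" using one_paramD(4)[OF e, of 0] by (simp add: e0)
    have W0: "e 0 \<in> W" by (simp add: e0 W)
    obtain T where T: "open T" "0 \<in> T" "\<And>s. s \<in> T \<Longrightarrow> e s \<in> W"
      using eventually_in_dom[of e 0, OF W0 e0'] by blast
    have "((\<lambda>t. f (e t)) has_vector_derivative D (e 0) Z) (at 0)"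
      by (rule has_vector_derivative_transform_within_open[OF along[of e 0, OF W0 e0'] T(1,2)])
        (simp add: fg[OF T(3) one_paramD(2)[OF e]])
    then have "D (e 0) Z = f (e 0) ** \<omega>"
      by (rule vector_derivative_unique_at[OF _ \<omega>'])
    then have "L Z = \<omega>"
      by (simp only: L_def e0 fg[OF W mat_1_in_unitary_group] unitaryD(5)[OF gU])
    then have "one_param \<omega> e'" using e' by simp
    then have "f (e t) = f (e 0) ** e' t"
      by (rule one_param_ode[of \<omega> e' "\<lambda>t. f (e t)", OF _ \<omega>(1) \<omega>'])
    then show ?thesis by (simp only: e0)
  qed
  ultimately show thesis by (rule that)
qed

section \<open>Quaternion coordinates on \<open>U(2)\<close>\<close>

lemma matrix_2_eq_iff:
  "A = B \<longleftrightarrow> A $ 1 $ 1 = B $ 1 $ 1 \<and> A $ 1 $ 2 = B $ 1 $ 2 \<and> A $ 2 $ 1 = B $ 2 $ 1 \<and> A $ 2 $ 2 = B $ 2 $ 2"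
  for A B :: "'a ^ 2 ^ 2"
  by (auto simp: vec_eq_iff forall_2)

text \<open>The usual matrix form of the quaternion a + b i + c j + d k. Those of norm one make up
  SU(2), and those with a = 0 make up su(2).\<close>

definition quat :: "real \<Rightarrow> real \<Rightarrow> real \<Rightarrow> real \<Rightarrow> complex ^ 2 ^ 2" where
  "quat a b c d = vector [vector [Complex a b, Complex c d], vector [Complex (- c) d, Complex a (- b)]]"

lemma quat_nth [simp]:
  "quat a b c d $ 1 $ 1 = Complex a b" "quat a b c d $ 1 $ 2 = Complex c d"
  "quat a b c d $ 2 $ 1 = Complex (- c) d" "quat a b c d $ 2 $ 2 = Complex a (- b)"
  by (simp_all add: quat_def)

lemma quat_eq_iff [simp]: "quat a b c d = quat a' b' c' d' \<longleftrightarrow> a = a' \<and> b = b' \<and> c = c' \<and> d = d'"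
  by (auto simp: matrix_2_eq_iff)

lemma mat_1_quat: "mat 1 = quat 1 0 0 0"
  by (simp add: matrix_2_eq_iff mat_def complex_eq_iff)

lemma quat_mult:
  "quat a b c d ** quat a' b' c' d' =
     quat (a * a' - b * b' - c * c' - d * d') (a * b' + b * a' + c * d' - d * c')
          (a * c' - b * d' + c * a' + d * b') (a * d' + b * c' - c * b' + d * a')"
  by (simp add: matrix_2_eq_iff matrix_matrix_mult_def sum_2 complex_eq_iff algebra_simps)

lemma quat_add: "quat a b c d + quat a' b' c' d' = quat (a + a') (b + b') (c + c') (d + d')"
  by (simp add: matrix_2_eq_iff complex_eq_iff)

lemma quat_scaleR: "r *\<^sub>R quat a b c d = quat (r * a) (r * b) (r * c) (r * d)"
  by (simp add: matrix_2_eq_iff complex_eq_iff)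

lemma quat_uminus: "- quat a b c d = quat (- a) (- b) (- c) (- d)"
  by (simp add: matrix_2_eq_iff complex_eq_iff)

lemma quat_conj_transpose: "(quat a b c d)\<^sup>\<dagger> = quat a (- b) (- c) (- d)"
  by (simp add: matrix_2_eq_iff conj_transpose_def complex_eq_iff)

lemma quat_trace: "trace (quat a b c d) = of_real (2 * a)"
  by (simp add: trace_def sum_2 complex_eq_iff)

lemma quat_inner: "quat a b c d \<bullet> quat a' b' c' d' = 2 * (a * a' + b * b' + c * c' + d * d')"
  by (simp add: inner_vec_def sum_2 inner_complex_def algebra_simps)

lemma quat_unitary: "a\<^sup>2 + b\<^sup>2 + c\<^sup>2 + d\<^sup>2 = 1 \<Longrightarrow> quat a b c d \<in> unitary_group"
  by (simp add: unitary_group_def quat_conj_transpose quat_mult mat_1_quat power2_eq_square algebra_simps)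

lemma scaled_unit_vector:
  fixes b c d :: real
  obtains r x y z where "b = r * x" "c = r * y" "d = r * z" "x\<^sup>2 + y\<^sup>2 + z\<^sup>2 = 1" "r\<^sup>2 = b\<^sup>2 + c\<^sup>2 + d\<^sup>2"
proof (cases "b\<^sup>2 + c\<^sup>2 + d\<^sup>2 = 0")
  case True
  then have "b = 0" "c = 0" "d = 0"
    by (smt (verit) power2_less_eq_zero_iff zero_le_power2)+
  \<comment> \<open>The zero vector has no direction of its own; any unit vector serves, with
    \<open>r\<close> equal to 0.\<close>
  then show ?thesis using that[of 0 1 0 0] by simp
next
  case False
  define r where "r = sqrt (b\<^sup>2 + c\<^sup>2 + d\<^sup>2)"
  have r: "r\<^sup>2 = b\<^sup>2 + c\<^sup>2 + d\<^sup>2" "r \<noteq> 0" using False by (auto simp: r_def)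
  have "(b / r)\<^sup>2 + (c / r)\<^sup>2 + (d / r)\<^sup>2 = (b\<^sup>2 + c\<^sup>2 + d\<^sup>2) / r\<^sup>2"
    by (simp add: power_divide add_divide_distrib)
  also have "\<dots> = 1" using r by (metis divide_self power_not_zero)
  finally show ?thesis using that[of r "b / r" "c / r" "d / r"] r by simp
qed

text \<open>The splitting of u(2) into its centre and su(2): \<open>\<tau>\<close> is the mean of
  the imaginary parts of the diagonal entries, which leaves a traceless remainder.\<close>

lemma skew_quat:
  assumes "Z \<in> (skew :: (complex ^ 2 ^ 2) set)"
  obtains \<tau> b c d where "Z = (\<i> * of_real \<tau>) *\<^sub>m mat 1 + quat 0 b c d"
proof -
  have e: "cnj (Z $ j $ i) = - Z $ i $ j" for i j
    using assms by (auto simp: skew_def conj_transpose_def vec_eq_iff)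
  define x where "x = Im (Z $ 1 $ 1)"
  define y where "y = Im (Z $ 2 $ 2)"
  have "Z = (\<i> * of_real ((x + y) / 2)) *\<^sub>m mat 1 + quat 0 ((x - y) / 2) (Re (Z $ 1 $ 2)) (Im (Z $ 1 $ 2))"
    using e[of 1 1] e[of 2 2] e[of 1 2]
    by (simp add: matrix_2_eq_iff cscale_def mat_def complex_eq_iff x_def y_def field_simps)
  then show ?thesis by (rule that)
qed

section \<open>One-parameter curves of U(2) in closed form\<close>

text \<open>For \<open>w\<close> with square -1 this is the exponential of t (i \<tau> + \<theta>
  w): a central phase times Euler's formula with \<open>w\<close> as imaginary unit.\<close>

definition circ :: "real \<Rightarrow> real \<Rightarrow> complex ^ 'n ^ 'n \<Rightarrow> real \<Rightarrow> complex ^ 'n ^ 'n" where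
  "circ \<tau> \<theta> w t = cis (t * \<tau>) *\<^sub>m (cos (t * \<theta>) *\<^sub>R mat 1 + sin (t * \<theta>) *\<^sub>R w)"

lemma one_param_circ:
  fixes w :: "complex ^ 'n ^ 'n"
  assumes w: "w\<^sup>\<dagger> = - w" "w ** w = - mat 1"
  shows "one_param ((\<i> * of_real \<tau>) *\<^sub>m mat 1 + \<theta> *\<^sub>R w) (circ \<tau> \<theta> w)" (is "one_param ?Z _")
  unfolding one_param_def
proof (intro conjI allI)
  note bil = matmul.add_left matmul.add_right matmul.scaleR_left matmul.scaleR_right
    matmul.minus_left matmul.minus_right cscale.add_right cscale.scaleR_right cscale.minus_right
    cscale.minus_left cscale.scaleR_left cscale.add_left
  show "circ \<tau> \<theta> w 0 = mat 1" by (simp add: circ_def)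
  fix t
  let ?q = "cos (t * \<theta>) *\<^sub>R mat 1 + sin (t * \<theta>) *\<^sub>R w"
  have q: "?q\<^sup>\<dagger> = cos (t * \<theta>) *\<^sub>R mat 1 - sin (t * \<theta>) *\<^sub>R w"
    by (simp add: conj_transpose_linear w(1))
  have cs: "cos (t * \<theta>) * cos (t * \<theta>) + sin (t * \<theta>) * sin (t * \<theta>) = 1"
    using sin_cos_squared_add2[of "t * \<theta>"] by (simp add: power2_eq_square add.commute)
  have "?q ** ?q\<^sup>\<dagger> = (cos (t * \<theta>) * cos (t * \<theta>)) *\<^sub>R mat 1 + (sin (t * \<theta>) * sin (t * \<theta>)) *\<^sub>R mat 1"
    "?q\<^sup>\<dagger> ** ?q = (cos (t * \<theta>) * cos (t * \<theta>)) *\<^sub>R mat 1 + (sin (t * \<theta>) * sin (t * \<theta>)) *\<^sub>R mat 1"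
    unfolding q by (simp_all add: bil matmul.diff_left matmul.diff_right w algebra_simps)
  then have qq: "?q ** ?q\<^sup>\<dagger> = mat 1" "?q\<^sup>\<dagger> ** ?q = mat 1"
    by (simp_all only: scaleR_add_left[symmetric] cs scaleR_one)
  have "cis a * cnj (cis a) = 1" for a
    by (simp add: cis_cnj cis_mult)
  then show "circ \<tau> \<theta> w t \<in> unitary_group"
    unfolding unitary_group_def circ_def mem_Collect_eq conj_transpose_cscale cscale_mult_left
      cscale_mult_right cscale_cscale qq by (simp add: mult.commute)
  show "?Z ** circ \<tau> \<theta> w t = circ \<tau> \<theta> w t ** ?Z"
    by (simp add: circ_def bil algebra_simps)
  have c: "((\<lambda>t. cis (t * \<tau>)) has_vector_derivative \<i> * of_real \<tau> * cis (t * \<tau>)) (at t)"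
  proof -
    have "((\<lambda>t. exp (of_real t * (\<i> * of_real \<tau>))) has_vector_derivative
        (\<i> * of_real \<tau>) * exp (of_real t * (\<i> * of_real \<tau>))) (at t)"
      by (auto intro!: derivative_eq_intros has_vector_derivative_real_field simp: mult_ac)
    then show ?thesis by (simp add: cis_conv_exp mult_ac)
  qed
  have co: "((\<lambda>t. cos (t * \<theta>)) has_real_derivative - (sin (t * \<theta>) * \<theta>)) (at t)"
    and si: "((\<lambda>t. sin (t * \<theta>)) has_real_derivative cos (t * \<theta>) * \<theta>) (at t)"
    by (auto intro!: derivative_eq_intros)
  have "((\<lambda>t. cos (t * \<theta>) *\<^sub>R mat 1 + sin (t * \<theta>) *\<^sub>R w) has_vector_derivative
      (cos (t * \<theta>) *\<^sub>R 0 + - (sin (t * \<theta>) * \<theta>) *\<^sub>R mat 1)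
      + (sin (t * \<theta>) *\<^sub>R 0 + (cos (t * \<theta>) * \<theta>) *\<^sub>R w)) (at t)"
    by (rule has_vector_derivative_add[OF has_vector_derivative_scaleR[OF co has_vector_derivative_const]
          has_vector_derivative_scaleR[OF si has_vector_derivative_const]])
  then have "(circ \<tau> \<theta> w has_vector_derivative
      cis (t * \<tau>) *\<^sub>m ((cos (t * \<theta>) *\<^sub>R 0 + - (sin (t * \<theta>) * \<theta>) *\<^sub>R mat 1)
      + (sin (t * \<theta>) *\<^sub>R 0 + (cos (t * \<theta>) * \<theta>) *\<^sub>R w))
      + (\<i> * of_real \<tau> * cis (t * \<tau>)) *\<^sub>m ?q) (at t)" (is "(_ has_vector_derivative ?v) _")
    unfolding circ_def[abs_def] by (rule cscale.has_vector_derivative[OF c])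
  moreover have "?v = circ \<tau> \<theta> w t ** ?Z"
    by (simp add: circ_def bil w(2) cscale.diff_right algebra_simps)
  ultimately show "(circ \<tau> \<theta> w has_vector_derivative circ \<tau> \<theta> w t ** ?Z) (at t)" by simp
qed

lemma quat_pure:
  assumes "b\<^sup>2 + c\<^sup>2 + d\<^sup>2 = 1"
  shows "(quat 0 b c d)\<^sup>\<dagger> = - quat 0 b c d" "quat 0 b c d ** quat 0 b c d = - mat 1"
  using assms by (simp_all add: quat_conj_transpose quat_uminus quat_mult mat_1_quat
      power2_eq_square algebra_simps)

lemma quat_skew: "quat 0 b c d \<in> skew"
  by (simp add: skew_def quat_conj_transpose quat_uminus)

lemma ex_one_param_2:
  fixes Z :: "complex ^ 2 ^ 2"
  assumes "Z \<in> skew"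
  shows "\<exists>e. one_param Z e"
proof -
  obtain \<tau> b c d where Z: "Z = (\<i> * of_real \<tau>) *\<^sub>m mat 1 + quat 0 b c d"
    by (rule skew_quat[OF assms])
  obtain r x y z where "b = r * x" "c = r * y" "d = r * z" "x\<^sup>2 + y\<^sup>2 + z\<^sup>2 = 1" "r\<^sup>2 = b\<^sup>2 + c\<^sup>2 + d\<^sup>2"
    by (rule scaled_unit_vector)
  then show ?thesis
    using one_param_circ[OF quat_pure, of x y z \<tau> r] unfolding Z by (auto simp: quat_scaleR)
qed

section \<open>Adjugates, determinants and the polar form of unitary matrices\<close>

lemma det_cscale_2: "det (c *\<^sub>m A) = c\<^sup>2 * det A" for A :: "complex ^ 2 ^ 2"
  by (simp add: det_2 cscale_def power2_eq_square algebra_simps)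

text \<open>In size 2 the adjugate is linear in the matrix, whereas the expression det X times the
  adjoint of X, with which it agrees on unitary matrices, is not. It linearises the two families of
  maps that involve the determinant.\<close>

definition adjugate :: "complex ^ 2 ^ 2 \<Rightarrow> complex ^ 2 ^ 2" where
  "adjugate X = vector [vector [X $ 2 $ 2, - X $ 1 $ 2], vector [- X $ 2 $ 1, X $ 1 $ 1]]"

lemma adjugate_nth [simp]:
  "adjugate X $ 1 $ 1 = X $ 2 $ 2" "adjugate X $ 1 $ 2 = - X $ 1 $ 2"
  "adjugate X $ 2 $ 1 = - X $ 2 $ 1" "adjugate X $ 2 $ 2 = X $ 1 $ 1"
  by (simp_all add: adjugate_def)

lemma mult_adjugate: "X ** adjugate X = det X *\<^sub>m mat 1" "adjugate X ** X = det X *\<^sub>m mat 1"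
  by (simp_all add: matrix_2_eq_iff matrix_matrix_mult_def sum_2 cscale_def mat_def det_2 algebra_simps)

lemma unitary_adjugate:
  assumes "X \<in> unitary_group"
  shows "adjugate X = det X *\<^sub>m X\<^sup>\<dagger>"
proof -
  have "adjugate X = X\<^sup>\<dagger> ** (X ** adjugate X)" by (rule unitaryD(5)[OF assms, symmetric])
  then show ?thesis by (simp add: mult_adjugate)
qed

lemma det_conj_transpose: "det (X\<^sup>\<dagger>) = cnj (det X)" for X :: "complex ^ 2 ^ 2"
  by (simp add: det_2 conj_transpose_def)

lemma norm_det_unitary:
  fixes X :: "complex ^ 2 ^ 2"
  assumes "X \<in> unitary_group"
  shows "det X * cnj (det X) = 1" "norm (det X) = 1"
proof -
  have "det X * det (X\<^sup>\<dagger>) = 1"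
    by (metis det_mul det_I unitaryD(1)[OF assms])
  then show "det X * cnj (det X) = 1" by (simp add: det_conj_transpose)
  then have "(norm (det X))\<^sup>2 = 1" by (metis complex_norm_square of_real_eq_1_iff)
  then show "norm (det X) = 1" by (simp add: power2_eq_1_iff) (smt (verit) norm_ge_zero)
qed

text \<open>Division by a square root of the determinant leaves a matrix of SU(2), that is, a unit
  quaternion; its real part is the cosine and the length of its imaginary part, up to sign, the sine
  of \<open>\<theta>\<close>.\<close>

lemma unitary_circ:
  fixes X :: "complex ^ 2 ^ 2"
  assumes X: "X \<in> unitary_group"
  obtains \<tau> \<theta> x y z where "X = circ \<tau> \<theta> (quat 0 x y z) 1" "x\<^sup>2 + y\<^sup>2 + z\<^sup>2 = 1" "det X = cis (2 * \<tau>)"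
proof -
  \<comment> \<open>Half the argument, because a scalar factor enters the determinant of a 2 by 2
    matrix squared.\<close>
  define \<tau> where "\<tau> = Arg (det X) / 2"
  have \<tau>: "det X = cis (2 * \<tau>)"
    using norm_det_unitary(2)[OF X] rcis_cmod_Arg[of "det X"] by (simp add: \<tau>_def rcis_def)
  define Y where "Y = cis (- \<tau>) *\<^sub>m X"
  have XY: "X = cis \<tau> *\<^sub>m Y" by (simp add: Y_def cis_mult)
  have "det Y = cis (- \<tau>) ^ 2 * cis (2 * \<tau>)" by (simp add: Y_def det_cscale_2 \<tau>)
  also have "\<dots> = 1" by (simp add: power2_eq_square cis_mult)
  finally have dY: "det Y = 1" .
  have "Y \<in> unitary_group"
    using unitaryD(1,2)[OF X] by (simp add: unitary_group_def Y_def cis_cnj cis_mult)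
  \<comment> \<open>With determinant 1 the adjugate is the adjoint, and comparing entries shows that
    \<open>Y\<close> has the shape of a quaternion.\<close>
  then have "adjugate Y = Y\<^sup>\<dagger>" using unitary_adjugate[of Y] dY by simp
  then have "adjugate Y $ 1 $ 1 = Y\<^sup>\<dagger> $ 1 $ 1" "- adjugate Y $ 2 $ 1 = - Y\<^sup>\<dagger> $ 2 $ 1" by (simp_all only:)
  then have e: "Y $ 2 $ 2 = cnj (Y $ 1 $ 1)" "Y $ 2 $ 1 = - cnj (Y $ 1 $ 2)"
    by (simp_all add: conj_transpose_def)
  define a b c d where "a = Re (Y $ 1 $ 1)" "b = Im (Y $ 1 $ 1)" "c = Re (Y $ 1 $ 2)" "d = Im (Y $ 1 $ 2)"
  have Y: "Y = quat a b c d"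
    by (simp add: matrix_2_eq_iff e a_b_c_d_def complex_eq_iff)
  have 1: "a\<^sup>2 + (b\<^sup>2 + c\<^sup>2 + d\<^sup>2) = 1"
    using dY by (simp add: det_2 Y complex_eq_iff power2_eq_square algebra_simps)
  obtain r x y z where r: "b = r * x" "c = r * y" "d = r * z" "x\<^sup>2 + y\<^sup>2 + z\<^sup>2 = 1" "r\<^sup>2 = b\<^sup>2 + c\<^sup>2 + d\<^sup>2"
    by (rule scaled_unit_vector)
  obtain \<theta> where \<theta>: "a = cos \<theta>" "r = sin \<theta>"
    using sincos_total_2pi[of a r] 1 r(5) by metis
  have "X = circ \<tau> \<theta> (quat 0 x y z) 1"
    unfolding XY Y circ_def mat_1_quat by (simp add: quat_scaleR quat_add r(1-3) \<theta>)
  then show ?thesis using that r(4) \<tau> by blast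
qed

section \<open>Conjugation by unitary matrices as rotation of su(2)\<close>

lemma circ_conj:
  assumes "A \<in> unitary_group"
  shows "circ \<tau> \<theta> (A\<^sup>\<dagger> ** w ** A) t = A\<^sup>\<dagger> ** circ \<tau> \<theta> w t ** A"
  by (simp add: circ_def matmul.add_left matmul.add_right matmul.scaleR_left matmul.scaleR_right
      unitaryD(2)[OF assms])

text \<open>If \<open>u\<close> and \<open>v\<close> are imaginary unit quaternions with \<open>v \<noteq> - u\<close> then \<open>1 - v u\<close> conjugates \<open>u\<close>
  to \<open>v\<close>.\<close>

lemma rotate_to_i:
  assumes n: "b\<^sup>2 + c\<^sup>2 + d\<^sup>2 = 1"
  shows "\<exists>A\<in>unitary_group. A ** quat 0 b c d ** A\<^sup>\<dagger> = quat 0 1 0 0"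
proof -
  have "\<exists>A\<in>unitary_group. A ** quat 0 b c d = quat 0 1 0 0 ** A"
  proof (cases "b = - 1")
    \<comment> \<open>The vector is now -i, for which the quaternion 1 - v u vanishes; conjugation
      by j does the job.\<close>
    case True
    then have "c\<^sup>2 + d\<^sup>2 = 0" using n by simp
    then have "c = 0" "d = 0" by (simp_all add: sum_power2_eq_zero_iff)
    then show ?thesis
      using True by (intro bexI[of _ "quat 0 0 1 0"]) (simp_all add: quat_mult quat_unitary)
  next
    case False
    have "b\<^sup>2 \<le> 1" using n by (smt (verit) zero_le_power2)
    then have "\<bar>b\<bar> \<le> 1" by (simp only: abs_square_le_1)
    then have b: "2 + 2 * b > 0" using False by linarith
    \<comment> \<open>The quaternion 1 - v u is here (1 + b) + d j - c k, of squared norm 2 + 2 b;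
      \<open>k\<close> normalises it.\<close>
    define k where "k = 1 / sqrt (2 + 2 * b)"
    have k: "k\<^sup>2 * (2 + 2 * b) = 1" using b by (simp add: k_def power_divide)
    have "(k * (1 + b))\<^sup>2 + 0\<^sup>2 + (k * d)\<^sup>2 + (- (k * c))\<^sup>2 = k\<^sup>2 * (1 + 2 * b + (b\<^sup>2 + c\<^sup>2 + d\<^sup>2))"
      by (simp add: power2_eq_square algebra_simps)
    also have "\<dots> = 1" using n k by (simp add: add.assoc[symmetric])
    finally have u: "quat (k * (1 + b)) 0 (k * d) (- (k * c)) \<in> unitary_group"
      by (rule quat_unitary)
    have "quat (1 + b) 0 d (- c) ** quat 0 b c d = quat 0 1 0 0 ** quat (1 + b) 0 d (- c)"
      using n by (simp add: quat_mult power2_eq_square algebra_simps)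
    then have "(k *\<^sub>R quat (1 + b) 0 d (- c)) ** quat 0 b c d = quat 0 1 0 0 ** (k *\<^sub>R quat (1 + b) 0 d (- c))"
      by (simp only: matmul.scaleR_left matmul.scaleR_right)
    then have "quat (k * (1 + b)) 0 (k * d) (- (k * c)) ** quat 0 b c d
        = quat 0 1 0 0 ** quat (k * (1 + b)) 0 (k * d) (- (k * c))"
      by (simp add: quat_scaleR)
    then show ?thesis using u by blast
  qed
  then show ?thesis by (metis unitaryD(3))
qed

text \<open>The same quaternion 1 - v u, with u = c j + d k and v = j, equals (1 + c) - d i. It
  commutes with i, so the axis already in place stays fixed. In the exceptional case u = -j,
  conjugation by i is used.\<close>

lemma rotate_to_j:
  assumes n: "c\<^sup>2 + d\<^sup>2 = 1"
  shows "\<exists>A\<in>unitary_group. A ** quat 0 1 0 0 ** A\<^sup>\<dagger> = quat 0 1 0 0 \<and> A ** quat 0 0 c d ** A\<^sup>\<dagger> = quat 0 0 1 0"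
proof -
  have "\<exists>A\<in>unitary_group. A ** quat 0 1 0 0 = quat 0 1 0 0 ** A \<and> A ** quat 0 0 c d = quat 0 0 1 0 ** A"
  proof (cases "c = - 1")
    case True
    then have "d = 0" using n by simp
    then show ?thesis
      using True by (intro bexI[of _ "quat 0 1 0 0"]) (simp_all add: quat_mult quat_unitary)
  next
    case False
    have "c\<^sup>2 \<le> 1" using n by (smt (verit) zero_le_power2)
    then have "\<bar>c\<bar> \<le> 1" by (simp only: abs_square_le_1)
    then have c: "2 + 2 * c > 0" using False by linarith
    define k where "k = 1 / sqrt (2 + 2 * c)"
    have k: "k\<^sup>2 * (2 + 2 * c) = 1" using c by (simp add: k_def power_divide)
    have "(k * (1 + c))\<^sup>2 + (- (k * d))\<^sup>2 + 0\<^sup>2 + 0\<^sup>2 = k\<^sup>2 * (1 + 2 * c + (c\<^sup>2 + d\<^sup>2))"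
      by (simp add: power2_eq_square algebra_simps)
    also have "\<dots> = 1" using n k by simp
    finally have u: "quat (k * (1 + c)) (- (k * d)) 0 0 \<in> unitary_group"
      by (rule quat_unitary)
    have "quat (1 + c) (- d) 0 0 ** quat 0 0 c d = quat 0 0 1 0 ** quat (1 + c) (- d) 0 0"
      using n by (simp add: quat_mult power2_eq_square algebra_simps)
    then have "(k *\<^sub>R quat (1 + c) (- d) 0 0) ** quat 0 0 c d = quat 0 0 1 0 ** (k *\<^sub>R quat (1 + c) (- d) 0 0)"
      by (simp only: matmul.scaleR_left matmul.scaleR_right)
    then have "quat (k * (1 + c)) (- (k * d)) 0 0 ** quat 0 0 c d
        = quat 0 0 1 0 ** quat (k * (1 + c)) (- (k * d)) 0 0"
      by (simp add: quat_scaleR)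
    moreover have "quat (k * (1 + c)) (- (k * d)) 0 0 ** quat 0 1 0 0
        = quat 0 1 0 0 ** quat (k * (1 + c)) (- (k * d)) 0 0"
      by (simp add: quat_mult)
    ultimately show ?thesis using u by blast
  qed
  then show ?thesis by (metis unitaryD(3))
qed

lemma inner_conj_unitary:
  fixes A :: "complex ^ 'n ^ 'n"
  assumes "A \<in> unitary_group"
  shows "(A ** X ** A\<^sup>\<dagger>) \<bullet> (A ** Y ** A\<^sup>\<dagger>) = X \<bullet> Y"
  by (simp only: inner_unitary_mult(1)[OF assms]
      inner_unitary_mult(2)[OF unitary_conj_transpose[OF assms]])

lemma trace_conj_unitary:
  fixes A :: "complex ^ 'n ^ 'n"
  assumes "A \<in> unitary_group"
  shows "trace (A ** X ** A\<^sup>\<dagger>) = trace X"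
  by (subst trace_mul_sym) (simp only: unitaryD(5)[OF assms])

lemma trace_skew_2: "trace ((\<i> * of_real \<tau>) *\<^sub>m mat 1 + quat 0 b c d) = 2 * \<i> * of_real \<tau>"
  by (simp add: trace_def sum_2 cscale_def mat_def complex_eq_iff)

lemma inner_skew_2:
  "((\<i> * of_real \<tau>) *\<^sub>m mat 1 + quat 0 b c d) \<bullet> ((\<i> * of_real \<tau>') *\<^sub>m mat 1 + quat 0 b' c' d')
    = 2 * (\<tau> * \<tau>' + b * b' + c * c' + d * d')"
  by (simp add: inner_vec_def sum_2 inner_complex_def cscale_def mat_def algebra_simps)

lemma traceless_skew_quat:
  assumes "Z \<in> skew" "trace Z = 0"
  obtains b c d where "Z = quat 0 b c d"
proof -
  obtain \<tau> b c d where Z: "Z = (\<i> * of_real \<tau>) *\<^sub>m mat 1 + quat 0 b c d"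
    by (rule skew_quat[OF assms(1)])
  then have "\<tau> = 0" using assms(2) by (simp add: trace_skew_2)
  then show ?thesis using that Z by (simp add: cscale.zero_left)
qed

lemma conj_quat:
  assumes "A \<in> unitary_group"
  obtains x y z where "A ** quat 0 b c d ** A\<^sup>\<dagger> = quat 0 x y z"
  by (rule traceless_skew_quat[OF skew_mult_conj[OF quat_skew, of A b c d]])
    (simp_all add: trace_conj_unitary[OF assms] quat_trace)

text \<open>Conjugation rotates su(2), so two orthogonal vectors can be moved to i and j and the
  third must then be plus or minus k. The sign \<open>s\<close> records the orientation of the
  frame. The squared length 2 is that of a unit quaternion in the Frobenius metric.\<close>

lemma align_basis:
  assumes u: "u1 = quat 0 b1 c1 d1" "u2 = quat 0 b2 c2 d2" "u3 = quat 0 b3 c3 d3"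
    and n: "u1 \<bullet> u1 = 2" "u2 \<bullet> u2 = 2" "u3 \<bullet> u3 = 2"
    and o: "u1 \<bullet> u2 = 0" "u1 \<bullet> u3 = 0" "u2 \<bullet> u3 = 0"
  obtains A s where "A \<in> unitary_group" "s = 1 \<or> s = - 1" "A ** u1 ** A\<^sup>\<dagger> = quat 0 s 0 0"
    "A ** u2 ** A\<^sup>\<dagger> = quat 0 0 s 0" "A ** u3 ** A\<^sup>\<dagger> = quat 0 0 0 s"
proof -
  have "b1\<^sup>2 + c1\<^sup>2 + d1\<^sup>2 = 1"
    using n(1) by (simp add: u quat_inner power2_eq_square)
  then obtain A1 where A1: "A1 \<in> unitary_group" "A1 ** u1 ** A1\<^sup>\<dagger> = quat 0 1 0 0"
    using rotate_to_i unfolding u by blast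
  obtain x y z where v2: "A1 ** u2 ** A1\<^sup>\<dagger> = quat 0 x y z"
    unfolding u by (rule conj_quat[OF A1(1)])
  have "x = 0" "y\<^sup>2 + z\<^sup>2 = 1"
    using inner_conj_unitary[OF A1(1), of u1 u2] inner_conj_unitary[OF A1(1), of u2 u2] n(2) o(1)
    unfolding A1(2) v2 by (simp_all add: quat_inner power2_eq_square)
  then obtain A2 where A2: "A2 \<in> unitary_group" "A2 ** quat 0 1 0 0 ** A2\<^sup>\<dagger> = quat 0 1 0 0"
    "A2 ** quat 0 x y z ** A2\<^sup>\<dagger> = quat 0 0 1 0"
    using rotate_to_j by blast
  define A where "A = A2 ** A1"
  have A: "A \<in> unitary_group" unfolding A_def by (rule unitary_mult[OF A2(1) A1(1)])
  have conj: "A ** X ** A\<^sup>\<dagger> = A2 ** (A1 ** X ** A1\<^sup>\<dagger>) ** A2\<^sup>\<dagger>" for X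
    by (simp only: A_def conj_transpose_mult matrix_mul_assoc)
  have w1: "A ** u1 ** A\<^sup>\<dagger> = quat 0 1 0 0" by (simp only: conj A1 A2)
  have w2: "A ** u2 ** A\<^sup>\<dagger> = quat 0 0 1 0" by (simp only: conj v2 A2)
  obtain p q r where w3: "A ** u3 ** A\<^sup>\<dagger> = quat 0 p q r"
    unfolding u by (rule conj_quat[OF A])
  have "p = 0" "q = 0" and r: "r\<^sup>2 = 1"
    using inner_conj_unitary[OF A, of u1 u3] inner_conj_unitary[OF A, of u2 u3]
      inner_conj_unitary[OF A, of u3 u3] n(3) o(2,3)
    unfolding w1 w2 w3 by (simp_all add: quat_inner power2_eq_square)
  then have w3: "A ** u3 ** A\<^sup>\<dagger> = quat 0 0 0 r" using w3 by simp
  show ?thesis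
  proof (cases "r = 1")
    case True
    then show ?thesis using that[of A 1] A w1 w2 w3 by simp
  next
    case False
    then have "r = - 1" using r by (simp add: power2_eq_1_iff)
    \<comment> \<open>Conjugation by k negates i and j and fixes k, so it carries the frame i, j, -k
      to -i, -j, -k with one common sign.\<close>
    have K: "quat 0 0 0 1 \<in> unitary_group" by (simp add: quat_unitary)
    have conj: "(quat 0 0 0 1 ** A) ** X ** (quat 0 0 0 1 ** A)\<^sup>\<dagger>
        = quat 0 0 0 1 ** (A ** X ** A\<^sup>\<dagger>) ** (quat 0 0 0 1)\<^sup>\<dagger>" for X
      by (simp only: conj_transpose_mult matrix_mul_assoc)
    show ?thesis
      by (rule that[of "quat 0 0 0 1 ** A" "- 1"])
        (simp_all only: conj w1 w2 w3 unitary_mult[OF K A],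
          simp_all add: quat_mult quat_conj_transpose \<open>r = - 1\<close>)
  qed
qed

section \<open>Closing of one-parameter curves and the splitting of u(2)\<close>

text \<open>The trace of the curve is twice a phase times a cosine. If it equals 2, the modulus
  forces the cosine to be 1 or -1, and then the phase is real.\<close>

lemma circ_closed:
  assumes "circ \<tau> \<theta> (quat 0 x y z) (2 * pi) = mat 1"
  shows "sin (2 * pi * \<tau>) = 0" "sin (2 * pi * \<theta>) = 0"
proof -
  have "trace (circ \<tau> \<theta> (quat 0 x y z) (2 * pi)) = 2"
    by (simp add: assms trace_def sum_2 mat_def)
  then have t: "cis (2 * pi * \<tau>) * of_real (cos (2 * pi * \<theta>)) = 1"
    by (simp add: circ_def mat_1_quat quat_scaleR quat_add quat_trace)
  have "norm (cis (2 * pi * \<tau>) * of_real (cos (2 * pi * \<theta>))) = 1"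
    unfolding t by simp
  then have c: "\<bar>cos (2 * pi * \<theta>)\<bar> = 1"
    by (simp add: norm_mult)
  then have "(cos (2 * pi * \<theta>))\<^sup>2 = 1" by (simp only: abs_square_eq_1)
  then show "sin (2 * pi * \<theta>) = 0"
    using sin_cos_squared_add[of "2 * pi * \<theta>"] by simp
  have "sin (2 * pi * \<tau>) * cos (2 * pi * \<theta>) = 0"
    using arg_cong[OF t, of Im] by simp
  then show "sin (2 * pi * \<tau>) = 0" using c by auto
qed

text \<open>Twice \<open>\<tau>\<close> and twice \<open>\<theta>\<close> are integers whose squares
  add up to 4, which happens only when one of them is 0 and the other 2 or -2.\<close>

lemma half_integer_circle:
  assumes \<tau>: "sin (2 * pi * \<tau>) = 0" and \<theta>: "sin (2 * pi * \<theta>) = 0" and n: "\<tau>\<^sup>2 + \<theta>\<^sup>2 = 1"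
  shows "\<tau> \<in> {0, 1, - 1}"
proof -
  obtain k l :: int where "2 * pi * \<tau> = of_int k * pi" "2 * pi * \<theta> = of_int l * pi"
    using \<tau> \<theta> unfolding sin_zero_iff_int2 by blast
  then have k: "2 * \<tau> = of_int k" and l: "2 * \<theta> = of_int l"
    by simp_all
  have "(2 * \<tau>)\<^sup>2 + (2 * \<theta>)\<^sup>2 = 4"
    using n by (simp add: power_mult_distrib)
  then have "real_of_int (k\<^sup>2 + l\<^sup>2) = real_of_int 4"
    by (simp add: k l)
  then have e: "k\<^sup>2 + l\<^sup>2 = 4"
    by (simp only: of_int_eq_iff)
  then have "k\<^sup>2 \<le> 4" "l\<^sup>2 \<le> 4"
    using zero_le_power2[of k] zero_le_power2[of l] by linarith+
  then have "\<bar>k\<bar> \<le> 2" "\<bar>l\<bar> \<le> 2"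
    using abs_le_square_iff[of k 2] abs_le_square_iff[of l 2] by simp_all
  then have "k \<in> {-2, -1, 0, 1, 2}" "l \<in> {-2, -1, 0, 1, 2}" by auto
  then have "k \<in> {-2, 0, 2}" using e by auto
  then show ?thesis using k by auto
qed

text \<open>The curve of a unit vector of su(2) closes at time 2 pi, so its image does too. As
  \<open>L\<close> preserves length, the central part \<open>\<tau>\<close> and the su(2) part of
  the image satisfy the circle equation with half-integer coordinates; the trace is 2 i times
  \<open>\<tau>\<close>.\<close>

lemma trace_image_closed:
  fixes f L :: "complex ^ 2 ^ 2 \<Rightarrow> complex ^ 2 ^ 2"
  assumes skew: "\<And>Z. Z \<in> skew \<Longrightarrow> L Z \<in> skew"
    and inner: "\<And>Z Z'. Z \<in> skew \<Longrightarrow> Z' \<in> skew \<Longrightarrow> L Z \<bullet> L Z' = Z \<bullet> Z'"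
    and geo: "\<forall>Z e e' t. Z \<in> skew \<longrightarrow> one_param Z e \<longrightarrow> one_param (L Z) e' \<longrightarrow> f (e t) = f (mat 1) ** e' t"
    and f1: "f (mat 1) \<in> unitary_group" and n: "b\<^sup>2 + c\<^sup>2 + d\<^sup>2 = 1"
  shows "Im (trace (L (quat 0 b c d))) \<in> {0, 2, - 2}"
proof -
  let ?Z = "quat 0 b c d"
  have Z: "?Z \<in> skew" by (rule quat_skew)
  obtain \<tau> p q s where L: "L ?Z = (\<i> * of_real \<tau>) *\<^sub>m mat 1 + quat 0 p q s"
    by (rule skew_quat[OF skew[OF Z]])
  obtain r x y z where r: "p = r * x" "q = r * y" "s = r * z" "x\<^sup>2 + y\<^sup>2 + z\<^sup>2 = 1" "r\<^sup>2 = p\<^sup>2 + q\<^sup>2 + s\<^sup>2"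
    by (rule scaled_unit_vector)
  have e: "one_param ?Z (circ 0 1 ?Z)"
    using one_param_circ[OF quat_pure[OF n], of 0 1] by (simp add: cscale.zero_left)
  have e': "one_param (L ?Z) (circ \<tau> r (quat 0 x y z))"
    using one_param_circ[OF quat_pure[OF r(4)], of \<tau> r] by (simp add: L r(1-3) quat_scaleR)
  have "circ 0 1 ?Z (2 * pi) = mat 1" by (simp add: circ_def)
  then have eq: "f (mat 1) = f (mat 1) ** circ \<tau> r (quat 0 x y z) (2 * pi)"
    using geo[rule_format, OF Z e e', of "2 * pi"] by simp
  have "(f (mat 1))\<^sup>\<dagger> ** f (mat 1) = (f (mat 1))\<^sup>\<dagger> ** (f (mat 1) ** circ \<tau> r (quat 0 x y z) (2 * pi))"
    by (simp only: eq[symmetric])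
  then have "circ \<tau> r (quat 0 x y z) (2 * pi) = mat 1"
    by (simp only: unitaryD(2,5)[OF f1])
  note closed = circ_closed[OF this]
  have "\<tau>\<^sup>2 + r\<^sup>2 = 1"
    using inner[OF Z Z] n unfolding L inner_skew_2 quat_inner r(5) by (simp add: power2_eq_square)
  then have "\<tau> \<in> {0, 1, - 1}" by (rule half_integer_circle[OF closed])
  then show ?thesis by (auto simp: L trace_skew_2)
qed

lemma linear_quat:
  assumes "linear L"
  shows "L (quat 0 b c d) = b *\<^sub>R L (quat 0 1 0 0) + c *\<^sub>R L (quat 0 0 1 0) + d *\<^sub>R L (quat 0 0 0 1)"
proof -
  have "quat 0 b c d = b *\<^sub>R quat 0 1 0 0 + c *\<^sub>R quat 0 0 1 0 + d *\<^sub>R quat 0 0 0 1"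
    by (simp add: quat_scaleR quat_add)
  then show ?thesis by (simp add: linear_add[OF assms] linear_scale[OF assms])
qed

section \<open>Normal form of an isometry and the four sign cases\<close>

lemma isometry_normal_form:
  fixes f :: "complex ^ 2 ^ 2 \<Rightarrow> complex ^ 2 ^ 2"
  assumes iso: "riemannian_isometry unitary_group frobenius_metric f"
  obtains A s h where "A \<in> unitary_group" "s = 1 \<or> s = - 1" "h = 1 \<or> h = - 1"
    "\<And>\<tau> \<theta> b c d. b\<^sup>2 + c\<^sup>2 + d\<^sup>2 = 1 \<Longrightarrow>
      f (circ \<tau> \<theta> (quat 0 b c d) 1) = f (mat 1) ** A\<^sup>\<dagger> ** circ (h * \<tau>) (s * \<theta>) (quat 0 b c d) 1 ** A"
proof -
  obtain L where lin: "linear L" and skew: "\<And>Z. Z \<in> skew \<Longrightarrow> L Z \<in> skew"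
    and inner: "\<And>Z Z'. Z \<in> skew \<Longrightarrow> Z' \<in> skew \<Longrightarrow> L Z \<bullet> L Z' = Z \<bullet> Z'"
    and geo: "\<forall>Z e e' t. Z \<in> skew \<longrightarrow> one_param Z e \<longrightarrow> one_param (L Z) e' \<longrightarrow> f (e t) = f (mat 1) ** e' t"
    using isometry_one_param[OF iso ex_one_param_2] by blast
  have f1: "f (mat 1) \<in> unitary_group"
    using iso bij_betw_apply[of f unitary_group unitary_group, OF _ mat_1_in_unitary_group]
    by (simp add: riemannian_isometry_def diffeomorphism_on_def)
  let ?i = "quat 0 1 0 0" and ?j = "quat 0 0 1 0" and ?k = "quat 0 0 0 1"
  \<comment> \<open>This linear functional measures the central component of the image; its
    vanishing on su(2) says that \<open>L\<close> maps su(2) into itself.\<close>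
  define a where "a Z = Im (trace (L Z))" for Z
  have a: "a (quat 0 b c d) \<in> {0, 2, - 2}" if "b\<^sup>2 + c\<^sup>2 + d\<^sup>2 = 1" for b c d
    unfolding a_def by (rule trace_image_closed[of L f, OF skew inner geo f1 that])
  have a_lin: "a (quat 0 b c d) = b * a ?i + c * a ?j + d * a ?k" for b c d
    unfolding a_def linear_quat[OF lin, of b c d] by (simp add: trace_def sum_2 algebra_simps)
  have v: "a ?i \<in> {0, 2, - 2}" "a ?j \<in> {0, 2, - 2}" "a ?k \<in> {0, 2, - 2}"
    by (rule a; simp)+
  \<comment> \<open>The triple 3, 4, 5 gives unit vectors with two nonzero rational coordinates. If
    p is 2 or -2 and q is 0, 2 or -2, then 3/5 p + 4/5 q has absolute value 2/5, 6/5 or 14/5, never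
    0 or 2. Three cyclic pairs of axes therefore eliminate all three values.\<close>
  have m: "a (quat 0 (3 / 5) (4 / 5) 0) \<in> {0, 2, - 2}" "a (quat 0 0 (3 / 5) (4 / 5)) \<in> {0, 2, - 2}"
    "a (quat 0 (4 / 5) 0 (3 / 5)) \<in> {0, 2, - 2}"
    by (rule a; simp add: power2_eq_square)+
  have eq_0: "p = 0" if "p \<in> {0, 2, - 2}" "q \<in> {0, 2, - 2}" "3 / 5 * p + 4 / 5 * q \<in> {0, 2, - 2}"
    for p q :: real
    using that by auto
  have a0: "a ?i = 0" "a ?j = 0" "a ?k = 0"
    using eq_0[OF v(1,2)] eq_0[OF v(2,3)] eq_0[OF v(3,1)] m
    unfolding a_lin[of "3 / 5" "4 / 5" 0] a_lin[of 0 "3 / 5" "4 / 5"] a_lin[of "4 / 5" 0 "3 / 5"]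
    by (simp_all only: mult_zero_left add_0_left add_0_right add.commute)
  have "\<exists>x y z. L (quat 0 b c d) = quat 0 x y z" if "a (quat 0 b c d) = 0" for b c d
  proof -
    obtain \<tau> x y z where L: "L (quat 0 b c d) = (\<i> * of_real \<tau>) *\<^sub>m mat 1 + quat 0 x y z"
      by (rule skew_quat[OF skew[OF quat_skew]])
    then have "\<tau> = 0" using that by (simp add: a_def trace_skew_2)
    then show ?thesis using L by (auto simp: cscale.zero_left)
  qed
  then obtain b1 c1 d1 b2 c2 d2 b3 c3 d3 where u: "L ?i = quat 0 b1 c1 d1" "L ?j = quat 0 b2 c2 d2"
    "L ?k = quat 0 b3 c3 d3"
    using a0 by metis
  obtain A s where A: "A \<in> unitary_group" and s: "s = 1 \<or> s = - 1"
    and AL: "A ** L ?i ** A\<^sup>\<dagger> = quat 0 s 0 0" "A ** L ?j ** A\<^sup>\<dagger> = quat 0 0 s 0"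
      "A ** L ?k ** A\<^sup>\<dagger> = quat 0 0 0 s"
    by (rule align_basis[OF u]) (simp_all add: inner quat_skew quat_inner)
  let ?c = "\<i> *\<^sub>m mat 1 :: complex ^ 2 ^ 2"
  have c: "?c = (\<i> * of_real 1) *\<^sub>m mat 1 + quat 0 0 0 0"
    by (simp add: matrix_2_eq_iff complex_eq_iff)
  have c_skew: "?c \<in> skew"
    by (simp add: skew_def cscale.minus_left)
  obtain h x y z where M: "A ** L ?c ** A\<^sup>\<dagger> = (\<i> * of_real h) *\<^sub>m mat 1 + quat 0 x y z"
    by (rule skew_quat[OF skew_mult_conj[OF skew[OF c_skew]]])
  \<comment> \<open>The image of the centre is orthogonal to the image of su(2), which after
    conjugation by \<open>A\<close> contains \<open>s\<close> times each of i, j and k. So it has no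
    su(2) part, and its length leaves only 1 and -1 for \<open>h\<close>.\<close>
  have orth: "((\<i> * of_real h) *\<^sub>m mat 1 + quat 0 x y z) \<bullet> (A ** L (quat 0 b c' d) ** A\<^sup>\<dagger>) = 0" for b c' d
    unfolding M[symmetric] inner_conj_unitary[OF A] inner[OF c_skew quat_skew]
    by (simp add: inner_vec_def sum_2 inner_complex_def cscale_def mat_def)
  have i0: "((\<i> * of_real h) *\<^sub>m mat 1 + quat 0 x y z) \<bullet> quat 0 b c' d = 2 * (x * b + y * c' + z * d)" for b c' d
    using inner_skew_2[of h x y z 0 b c' d] by (simp add: cscale.zero_left)
  have "x * s = 0" "y * s = 0" "z * s = 0"
    using orth[of 1 0 0] orth[of 0 1 0] orth[of 0 0 1] unfolding AL i0 by simp_all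
  then have "x = 0" "y = 0" "z = 0" using s by auto
  then have M: "A ** L ?c ** A\<^sup>\<dagger> = (\<i> * of_real h) *\<^sub>m mat 1 + quat 0 0 0 0" using M by simp
  have "?c \<bullet> ?c = 2"
    unfolding c inner_skew_2 by simp
  then have "(A ** L ?c ** A\<^sup>\<dagger>) \<bullet> (A ** L ?c ** A\<^sup>\<dagger>) = 2"
    by (simp only: inner_conj_unitary[OF A] inner[OF c_skew c_skew])
  then have "h\<^sup>2 = 1" unfolding M inner_skew_2 by (simp add: power2_eq_square)
  then have h: "h = 1 \<or> h = - 1" by (simp add: power2_eq_1_iff)
  have conj_back: "X = A\<^sup>\<dagger> ** (A ** X ** A\<^sup>\<dagger>) ** A" for X :: "complex ^ 2 ^ 2"
    by (simp only: matrix_mul_assoc[symmetric] unitaryD(2)[OF A] unitaryD(5)[OF A] matrix_mul_rid)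
  have Lc: "L ?c = (\<i> * of_real h) *\<^sub>m mat 1"
  proof -
    have "L ?c = A\<^sup>\<dagger> ** ((\<i> * of_real h) *\<^sub>m mat 1 + quat 0 0 0 0) ** A"
      using conj_back[of "L ?c"] unfolding M .
    also have "quat 0 0 0 0 = 0" by (simp add: matrix_2_eq_iff complex_eq_iff)
    finally show ?thesis by (simp add: unitaryD(2)[OF A])
  qed
  have "f (circ \<tau> \<theta> (quat 0 b c d) 1) = f (mat 1) ** A\<^sup>\<dagger> ** circ (h * \<tau>) (s * \<theta>) (quat 0 b c d) 1 ** A"
    if n: "b\<^sup>2 + c\<^sup>2 + d\<^sup>2 = 1" for \<tau> \<theta> b c d
  proof -
    let ?w = "quat 0 b c d"
    let ?w' = "A\<^sup>\<dagger> ** ?w ** A"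
    let ?Z = "(\<i> * of_real \<tau>) *\<^sub>m mat 1 + \<theta> *\<^sub>R ?w"
    have Z: "?Z = \<tau> *\<^sub>R ?c + \<theta> *\<^sub>R ?w"
      by (simp add: matrix_2_eq_iff cscale_def mat_def complex_eq_iff algebra_simps)
    have Zs: "?Z \<in> skew"
      unfolding Z by (intro subspace_add subspace_scale subspace_skew c_skew quat_skew)
    have "A ** L ?w ** A\<^sup>\<dagger> = s *\<^sub>R ?w"
      unfolding linear_quat[OF lin, of b c d] matmul.add_left matmul.add_right matmul.scaleR_left
        matmul.scaleR_right AL by (simp add: quat_scaleR quat_add mult.commute)
    then have "L ?w = A\<^sup>\<dagger> ** (s *\<^sub>R ?w) ** A" using conj_back[of "L ?w"] by simp
    then have Lw: "L ?w = s *\<^sub>R ?w'" by (simp only: matmul.scaleR_left matmul.scaleR_right)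
    have "L ?Z = \<tau> *\<^sub>R L ?c + \<theta> *\<^sub>R L ?w"
      unfolding Z by (simp only: linear_add[OF lin] linear_scale[OF lin])
    then have LZ: "L ?Z = (\<i> * of_real (h * \<tau>)) *\<^sub>m mat 1 + (s * \<theta>) *\<^sub>R ?w'"
      unfolding Lc Lw by (simp add: matrix_2_eq_iff cscale_def mat_def complex_eq_iff algebra_simps)
    \<comment> \<open>The conjugated vector is again skew-Hermitian with square -1, so the closed
      form \<open>circ\<close> applies to the image curve as well.\<close>
    have w': "?w'\<^sup>\<dagger> = - ?w'" "?w' ** ?w' = - mat 1"
    proof -
      show "?w'\<^sup>\<dagger> = - ?w'"
        by (simp add: conj_transpose_mult quat_pure(1)[OF n] matrix_mul_assoc matmul.minus_left matmul.minus_right)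
      have "?w' ** ?w' = A\<^sup>\<dagger> ** (?w ** (A ** (A\<^sup>\<dagger> ** (?w ** A))))"
        by (simp only: matrix_mul_assoc)
      also have "\<dots> = A\<^sup>\<dagger> ** ((?w ** ?w) ** A)"
        by (subst unitaryD(6)[OF A]) (simp only: matrix_mul_assoc)
      also have "\<dots> = - mat 1"
        by (simp only: quat_pure(2)[OF n] matmul.minus_left matmul.minus_right matrix_mul_lid unitaryD(2)[OF A])
      finally show "?w' ** ?w' = - mat 1" .
    qed
    have "f (circ \<tau> \<theta> ?w 1) = f (mat 1) ** circ (h * \<tau>) (s * \<theta>) ?w' 1"
      using geo[rule_format, OF Zs one_param_circ[OF quat_pure[OF n]]] one_param_circ[OF w', of "h * \<tau>" "s * \<theta>"]
      unfolding LZ by blast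
    then show ?thesis by (simp only: circ_conj[OF A] matrix_mul_assoc)
  qed
  then show thesis by (rule that[OF A s h])
qed

text \<open>Every unitary matrix is a value of \<open>circ\<close> at time 1, where the normal form
  describes \<open>f\<close>. The adjoint flips the signs of both \<open>\<tau>\<close> and
  \<open>\<theta>\<close>. Since the determinant is the phase of angle 2 \<tau>, dividing by it
  flips \<open>\<tau>\<close> alone, and multiplying the adjoint by it flips \<open>\<theta>\<close>
  alone. So the four pairs \<open>h\<close>, \<open>s\<close> give the four families, with left
  factor \<open>?B\<close> and right factor \<open>A\<close>.\<close>

lemma isometry_imp_form:
  fixes f :: "complex ^ 2 ^ 2 \<Rightarrow> complex ^ 2 ^ 2"
  assumes iso: "riemannian_isometry unitary_group frobenius_metric f"
  shows "\<exists>A\<in>unitary_group. \<exists>B\<in>unitary_group.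
        (\<forall>X\<in>unitary_group. f X = A ** X ** B)
      \<or> (\<forall>X\<in>unitary_group. f X = A ** X\<^sup>\<dagger> ** B)
      \<or> (\<forall>X\<in>unitary_group. f X = (1 / det X) *\<^sub>m (A ** X ** B))
      \<or> (\<forall>X\<in>unitary_group. f X = det X *\<^sub>m (A ** X\<^sup>\<dagger> ** B))"
proof -
  obtain A s h where A: "A \<in> unitary_group" and s: "s = 1 \<or> s = - 1" and h: "h = 1 \<or> h = - 1"
    and f: "\<And>\<tau> \<theta> b c d. b\<^sup>2 + c\<^sup>2 + d\<^sup>2 = 1 \<Longrightarrow>
      f (circ \<tau> \<theta> (quat 0 b c d) 1) = f (mat 1) ** A\<^sup>\<dagger> ** circ (h * \<tau>) (s * \<theta>) (quat 0 b c d) 1 ** A"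
    using isometry_normal_form[OF iso] by blast
  let ?B = "f (mat 1) ** A\<^sup>\<dagger>"
  have "f (mat 1) \<in> unitary_group"
    using iso bij_betw_apply[of f unitary_group unitary_group, OF _ mat_1_in_unitary_group]
    by (simp add: riemannian_isometry_def diffeomorphism_on_def)
  then have B: "?B \<in> unitary_group"
    by (rule unitary_mult[OF _ unitary_conj_transpose[OF A]])
  have ct: "(circ \<tau> \<theta> (quat 0 b c d) 1)\<^sup>\<dagger> = circ (- \<tau>) (- \<theta>) (quat 0 b c d) 1" for \<tau> \<theta> b c d
    by (simp add: circ_def mat_1_quat quat_scaleR quat_add quat_conj_transpose cis_cnj)
  have shift: "cis \<sigma> *\<^sub>m circ \<tau> \<theta> (quat 0 b c d) 1 = circ (\<sigma> + \<tau>) \<theta> (quat 0 b c d) 1" for \<sigma> \<tau> \<theta> b c d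
    by (simp add: circ_def cis_mult)
  have "(\<forall>X\<in>unitary_group. f X = ?B ** X ** A)" if "h = 1" "s = 1"
  proof
    fix X :: "complex ^ 2 ^ 2" assume "X \<in> unitary_group"
    then obtain \<tau> \<theta> x y z where X: "X = circ \<tau> \<theta> (quat 0 x y z) 1" "x\<^sup>2 + y\<^sup>2 + z\<^sup>2 = 1" "det X = cis (2 * \<tau>)"
      by (rule unitary_circ)
    show "f X = ?B ** X ** A" using f[OF X(2), of \<tau> \<theta>] that by (simp add: X(1))
  qed
  moreover have "(\<forall>X\<in>unitary_group. f X = ?B ** X\<^sup>\<dagger> ** A)" if "h = - 1" "s = - 1"
  proof
    fix X :: "complex ^ 2 ^ 2" assume "X \<in> unitary_group"
    then obtain \<tau> \<theta> x y z where X: "X = circ \<tau> \<theta> (quat 0 x y z) 1" "x\<^sup>2 + y\<^sup>2 + z\<^sup>2 = 1" "det X = cis (2 * \<tau>)"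
      by (rule unitary_circ)
    show "f X = ?B ** X\<^sup>\<dagger> ** A" using f[OF X(2), of \<tau> \<theta>] that by (simp add: X(1) ct)
  qed
  moreover have "(\<forall>X\<in>unitary_group. f X = (1 / det X) *\<^sub>m (?B ** X ** A))" if "h = - 1" "s = 1"
  proof
    fix X :: "complex ^ 2 ^ 2" assume "X \<in> unitary_group"
    then obtain \<tau> \<theta> x y z where X: "X = circ \<tau> \<theta> (quat 0 x y z) 1" "x\<^sup>2 + y\<^sup>2 + z\<^sup>2 = 1" "det X = cis (2 * \<tau>)"
      by (rule unitary_circ)
    have d: "1 / det X = cis (- (2 * \<tau>))" by (simp add: X(3) cis_inverse divide_inverse)
    have "(1 / det X) *\<^sub>m X = circ (- \<tau>) \<theta> (quat 0 x y z) 1"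
      unfolding d unfolding X(1) shift by simp
    then have "?B ** ((1 / det X) *\<^sub>m X) ** A = f X" using f[OF X(2), of \<tau> \<theta>] that by (simp add: X(1))
    then show "f X = (1 / det X) *\<^sub>m (?B ** X ** A)" by simp
  qed
  moreover have "(\<forall>X\<in>unitary_group. f X = det X *\<^sub>m (?B ** X\<^sup>\<dagger> ** A))" if "h = 1" "s = - 1"
  proof
    fix X :: "complex ^ 2 ^ 2" assume "X \<in> unitary_group"
    then obtain \<tau> \<theta> x y z where X: "X = circ \<tau> \<theta> (quat 0 x y z) 1" "x\<^sup>2 + y\<^sup>2 + z\<^sup>2 = 1" "det X = cis (2 * \<tau>)"
      by (rule unitary_circ)
    have "det X *\<^sub>m X\<^sup>\<dagger> = circ \<tau> (- \<theta>) (quat 0 x y z) 1"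
      unfolding X(3) unfolding X(1) ct shift by simp
    then have "?B ** (det X *\<^sub>m X\<^sup>\<dagger>) ** A = f X" using f[OF X(2), of \<tau> \<theta>] that by (simp add: X(1))
    then show "f X = det X *\<^sub>m (?B ** X\<^sup>\<dagger> ** A)" by simp
  qed
  ultimately show ?thesis using A B s h by blast
qed

section \<open>Linear isometries preserving the unitary group\<close>

text \<open>A linear map is its own derivative, so preserving the inner product of the matrix space
  gives the metric condition at every point; the linear inverse \<open>T'\<close> supplies the
  smooth inverse. Agreement of \<open>f\<close> with \<open>T\<close> on the group fixes the
  differential on tangent vectors through the velocities of curves.\<close>

lemma linear_imp_isometry:
  fixes f T T' :: "complex ^ 'n ^ 'n \<Rightarrow> complex ^ 'n ^ 'n"
  assumes T: "linear T" "linear T'"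
    and TU: "\<And>X. X \<in> unitary_group \<Longrightarrow> T X \<in> unitary_group"
    and T'U: "\<And>X. X \<in> unitary_group \<Longrightarrow> T' X \<in> unitary_group"
    and inv: "\<And>X. T' (T X) = X" "\<And>X. T (T' X) = X"
    and inner: "\<And>X Y. T X \<bullet> T Y = X \<bullet> Y"
    and f: "\<And>X. X \<in> unitary_group \<Longrightarrow> f X = T X"
  shows "riemannian_isometry unitary_group frobenius_metric f"
proof -
  have bl: "bounded_linear T" "bounded_linear T'" using T linear_linear by blast+
  have bij: "bij_betw f unitary_group unitary_group"
    by (rule bij_betw_byWitness[of _ T']) (auto simp: f inv TU T'U)
  have inv_f: "inv_into unitary_group f Y = T' Y" if "Y \<in> unitary_group" for Y
    by (rule inv_into_f_eq) (use bij that in \<open>auto simp: bij_betw_def f inv T'U\<close>)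
  have smooth: "smooth_map_on unitary_group h"
    if S: "bounded_linear S" and h: "\<And>X. X \<in> unitary_group \<Longrightarrow> h X = S X"
    for h S :: "complex ^ 'n ^ 'n \<Rightarrow> complex ^ 'n ^ 'n"
    unfolding smooth_map_on_def
    by (intro ballI exI[of _ UNIV] exI[of _ S]) (simp add: Ck_on_bounded_linear[OF S] h)
  have D: "frechet_derivative f (at p within unitary_group) v = T v"
    if p: "p \<in> unitary_group" and v: "v \<in> tangent_space unitary_group p" for p v
  proof -
    obtain \<epsilon> and \<gamma> :: "real \<Rightarrow> complex ^ 'n ^ 'n"
      where \<epsilon>: "\<epsilon> > 0" and \<gamma>: "\<gamma> ` {-\<epsilon><..<\<epsilon>} \<subseteq> unitary_group" "\<gamma> 0 = p"
        "(\<gamma> has_vector_derivative v) (at 0)"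
      using v unfolding tangent_space_def by blast
    have "(f has_derivative T) (at p within unitary_group)"
      by (rule has_derivative_transform[OF p _ bounded_linear_imp_has_derivative[OF bl(1)]]) (rule f)
    then have "f differentiable (at p within unitary_group)"
      by (rule differentiableI)
    then have 1: "((f \<circ> \<gamma>) has_vector_derivative frechet_derivative f (at p within unitary_group) v) (at 0)"
      by (rule frechet_derivative_within_tangent[OF _ \<epsilon> \<gamma>])
    have "((\<lambda>t. T (\<gamma> t)) has_vector_derivative T v) (at 0)"
      by (rule bounded_linear.has_vector_derivative[OF bl(1) \<gamma>(3)])
    then have "((f \<circ> \<gamma>) has_vector_derivative T v) (at 0)"
      by (rule has_vector_derivative_transform_within_open[of _ _ _ "{-\<epsilon><..<\<epsilon>}"])
        (use \<epsilon> \<gamma>(1) f in \<open>auto simp: image_subset_iff\<close>)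
    then show ?thesis by (rule vector_derivative_unique_at[OF 1])
  qed
  show ?thesis
    unfolding riemannian_isometry_def diffeomorphism_on_def
    using bij smooth[OF bl(1) f] smooth[OF bl(2) inv_f] by (simp add: frobenius_metric_eq_inner D inner)
qed

text \<open>The common shape of all four families: \<open>J\<close> will be the identity, the
  adjoint, the adjugate, or the adjoint of the adjugate. Being an involution, \<open>J\<close> also
  provides the inverse map.\<close>

lemma linear_involution_imp_isometry:
  fixes f J :: "complex ^ 'n ^ 'n \<Rightarrow> complex ^ 'n ^ 'n"
  assumes A: "A \<in> unitary_group" and B: "B \<in> unitary_group"
    and J: "linear J" and JU: "\<And>X. X \<in> unitary_group \<Longrightarrow> J X \<in> unitary_group"
    and JJ: "\<And>X. J (J X) = X" and inner: "\<And>X Y. J X \<bullet> J Y = X \<bullet> Y"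
    and f: "\<And>X. X \<in> unitary_group \<Longrightarrow> f X = A ** J X ** B"
  shows "riemannian_isometry unitary_group frobenius_metric f"
proof (rule linear_imp_isometry[where T = "\<lambda>X. A ** J X ** B" and T' = "\<lambda>X. J (A\<^sup>\<dagger> ** X ** B\<^sup>\<dagger>)"])
  note add = matmul.add_left matmul.add_right linear_add[OF J]
  note scale = matmul.scaleR_left matmul.scaleR_right linear_scale[OF J]
  show "linear (\<lambda>X. A ** J X ** B)" "linear (\<lambda>X. J (A\<^sup>\<dagger> ** X ** B\<^sup>\<dagger>))"
    by (rule linearI; simp only: add scale)+
  show "A ** J X ** B \<in> unitary_group" "J (A\<^sup>\<dagger> ** X ** B\<^sup>\<dagger>) \<in> unitary_group"
    if "X \<in> unitary_group" for X
    using that A B by (simp_all add: unitary_mult unitary_conj_transpose JU)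
  show "J (A\<^sup>\<dagger> ** (A ** J X ** B) ** B\<^sup>\<dagger>) = X" for X
  proof -
    have "A\<^sup>\<dagger> ** (A ** J X ** B) ** B\<^sup>\<dagger> = A\<^sup>\<dagger> ** (A ** (J X ** B ** B\<^sup>\<dagger>))"
      by (simp only: matrix_mul_assoc)
    then show ?thesis by (simp only: unitaryD(5)[OF A] unitaryD(3)[OF B] JJ)
  qed
  show "A ** J (J (A\<^sup>\<dagger> ** X ** B\<^sup>\<dagger>)) ** B = X" for X
  proof -
    have "A ** (A\<^sup>\<dagger> ** X ** B\<^sup>\<dagger>) ** B = A ** (A\<^sup>\<dagger> ** (X ** B\<^sup>\<dagger> ** B))"
      by (simp only: matrix_mul_assoc)
    then show ?thesis by (simp only: unitaryD(6)[OF A] unitaryD(4)[OF B] JJ)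
  qed
  show "(A ** J X ** B) \<bullet> (A ** J Y ** B) = X \<bullet> Y" for X Y
    by (simp only: inner_unitary_mult(2)[OF B] inner_unitary_mult(1)[OF A] inner)
qed (rule f)

lemma linear_adjugate: "linear adjugate"
  by (rule linearI) (simp_all add: matrix_2_eq_iff)

lemma adjugate_adjugate: "adjugate (adjugate X) = X"
  by (simp add: matrix_2_eq_iff)

lemma adjugate_conj_transpose: "adjugate (X\<^sup>\<dagger>) = (adjugate X)\<^sup>\<dagger>"
  by (simp add: matrix_2_eq_iff conj_transpose_def)

text \<open>The adjugate only permutes the entries and changes the signs of two of them.\<close>

lemma inner_adjugate: "adjugate X \<bullet> adjugate Y = X \<bullet> Y"
  by (simp add: inner_vec_def sum_2)

lemma unitary_cscale:
  assumes "X \<in> unitary_group" "c * cnj c = 1"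
  shows "c *\<^sub>m X \<in> unitary_group"
  using unitaryD(1,2)[OF assms(1)] assms(2) by (simp add: unitary_group_def mult.commute)

lemma adjugate_unitary: "X \<in> unitary_group \<Longrightarrow> adjugate X \<in> unitary_group"
  by (simp add: unitary_adjugate unitary_cscale unitary_conj_transpose norm_det_unitary(1))

theorem theorem4p7:
  fixes f :: "complex ^ 2 ^ 2 \<Rightarrow> complex ^ 2 ^ 2"
  shows "riemannian_isometry unitary_group frobenius_metric f \<longleftrightarrow>
    (\<exists>A\<in>unitary_group. \<exists>B\<in>unitary_group.
        (\<forall>X\<in>unitary_group. f X = A ** X ** B)
      \<or> (\<forall>X\<in>unitary_group. f X = A ** X\<^sup>\<dagger> ** B)
      \<or> (\<forall>X\<in>unitary_group. f X = (1 / det X) *\<^sub>m (A ** X ** B))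
      \<or> (\<forall>X\<in>unitary_group. f X = det X *\<^sub>m (A ** X\<^sup>\<dagger> ** B)))"
proof
  assume "riemannian_isometry unitary_group frobenius_metric f"
  then show "\<exists>A\<in>unitary_group. \<exists>B\<in>unitary_group.
        (\<forall>X\<in>unitary_group. f X = A ** X ** B)
      \<or> (\<forall>X\<in>unitary_group. f X = A ** X\<^sup>\<dagger> ** B)
      \<or> (\<forall>X\<in>unitary_group. f X = (1 / det X) *\<^sub>m (A ** X ** B))
      \<or> (\<forall>X\<in>unitary_group. f X = det X *\<^sub>m (A ** X\<^sup>\<dagger> ** B))"
    by (rule isometry_imp_form)
next
  assume "\<exists>A\<in>unitary_group. \<exists>B\<in>unitary_group.
        (\<forall>X\<in>unitary_group. f X = A ** X ** B)
      \<or> (\<forall>X\<in>unitary_group. f X = A ** X\<^sup>\<dagger> ** B)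
      \<or> (\<forall>X\<in>unitary_group. f X = (1 / det X) *\<^sub>m (A ** X ** B))
      \<or> (\<forall>X\<in>unitary_group. f X = det X *\<^sub>m (A ** X\<^sup>\<dagger> ** B))"
  then obtain A B where A: "A \<in> unitary_group" and B: "B \<in> unitary_group" and
    f: "(\<forall>X\<in>unitary_group. f X = A ** X ** B)
      \<or> (\<forall>X\<in>unitary_group. f X = A ** X\<^sup>\<dagger> ** B)
      \<or> (\<forall>X\<in>unitary_group. f X = (1 / det X) *\<^sub>m (A ** X ** B))
      \<or> (\<forall>X\<in>unitary_group. f X = det X *\<^sub>m (A ** X\<^sup>\<dagger> ** B))"
    by blast
  note iso = linear_involution_imp_isometry[OF A B]
  \<comment> \<open>The determinant of a unitary matrix lies on the unit circle, where inversion is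
    conjugation.\<close>
  have inv_det: "1 / det X = cnj (det X)" if "X \<in> unitary_group" for X :: "complex ^ 2 ^ 2"
    using norm_det_unitary(1)[OF that] by (metis div_by_0 mult_zero_left nonzero_eq_divide_eq mult.commute zero_neq_one)
  from f show "riemannian_isometry unitary_group frobenius_metric f"
  proof (elim disjE)
    assume "\<forall>X\<in>unitary_group. f X = A ** X ** B"
    then show ?thesis
      by (intro iso[of "\<lambda>X. X"]) (simp_all add: linear_ident)
  next
    assume "\<forall>X\<in>unitary_group. f X = A ** X\<^sup>\<dagger> ** B"
    then show ?thesis
      by (intro iso[of conj_transpose])
        (simp_all add: linear_conj_transpose unitary_conj_transpose inner_conj_transpose)
  next
    assume "\<forall>X\<in>unitary_group. f X = (1 / det X) *\<^sub>m (A ** X ** B)"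
    \<comment> \<open>The adjoint of the adjugate of a unitary \<open>X\<close> is the conjugate
      determinant times \<open>X\<close>, that is, \<open>X\<close> divided by its
      determinant.\<close>
    then have "f X = A ** (adjugate X)\<^sup>\<dagger> ** B" if "X \<in> unitary_group" for X
      using that by (simp add: unitary_adjugate inv_det)
    then show ?thesis
      by (intro iso[of "\<lambda>X. (adjugate X)\<^sup>\<dagger>"])
        (simp_all add: linear_compose[OF linear_adjugate linear_conj_transpose, unfolded o_def] adjugate_unitary
          unitary_conj_transpose inner_conj_transpose inner_adjugate adjugate_adjugate adjugate_conj_transpose)
  next
    assume "\<forall>X\<in>unitary_group. f X = det X *\<^sub>m (A ** X\<^sup>\<dagger> ** B)"
    then have "f X = A ** adjugate X ** B" if "X \<in> unitary_group" for X
      using that by (simp add: unitary_adjugate)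
    then show ?thesis
      by (intro iso[of adjugate]) (simp_all add: linear_adjugate adjugate_unitary inner_adjugate adjugate_adjugate)
  qed
qed

end
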